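(* Let $P\subset N_{\mathbb R}$ be a rational polyhedron with at least one vertex, and fix a reference vertex $v_*$ of $P$. Then the universal Minkowski summand (tautological cone) $\widetilde{\mathcal T}_+(P)=\{(\xi,w):\xi\in\mathcal T_+(P),\ w\in P_\xi\}\subseteq\mathcal T_+(P)\times N_{\mathbb R}$ is a convex polyhedral cone.
   Context: $N$ is a free abelian group of finite rank, $N_{\mathbb R}=N\otimes\mathbb R$. $P\subset N_{\mathbb R}$ is a rational polyhedron with at least one vertex, $\mathrm{tail}(P)=\{a:a+P\subseteq P\}$. Let $v^1,\dots,v^m$ be the vertices and $r$ the number of compact edges of $P$; a compact edge $d$ with endpoints $v^i,v^j$ is also regarded, after choosing an orientation, as the vector $v^j-v^i$. For each compact 2-face $F$ choose signs $\varepsilon_F(d)\in\{\pm1\}$ ($d\subset F$ an edge) so that the vectors $\varepsilon_F(d)\,d$ form an oriented cycle along $\partial F$. For a half-open compact edge $[v,w)$ let $g\ge1$ be the least integer such that the affine line through $gv$ and $gw$ contains a point of $N$; $[v,w)$ is short if $|g[v,w)\cap N|\le g-1$. $\mathcal T(P)\subseteq\mathbb R^r\oplus\mathbb R^m$ is the set of $(t,s)$, $t=(t_d)=(t_{ij})$, $s=(s_i)=(s_{v^i})$, with: $\sum_{d\subset F}\varepsilon_F(d)t_d\,d=0$ for all compact 2-faces $F$; $s_i=0$ if $v^i\in N$; $s_i=s_j$ if $[v^i,v^j]$ is a compact edge with $[v^i,v^j]\cap N=\emptyset$; $s_i=t_{ij}$ if $[v^i,v^j)$ is a short half-open edge. $\mathcal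 T_+(P)=\mathcal T(P)\cap(\mathbb R^r_{\ge0}\oplus\mathbb R^m_{\ge0})$. For $\xi\in\mathcal T_+(P)$ (with coordinates $t_{ij}(\xi),s_v(\xi)$) and a vertex $v$ choose a path $v_*=u^0,u^1,\dots,u^l=v$ along compact edges of $P$ and put $\psi(\xi,v)=s_{v_*}(\xi)v_*+\sum_{j=1}^l t_{u^{j-1}u^j}(\xi)(u^j-u^{j-1})$ (independent of the path), and $P_\xi=\mathrm{conv}\{\psi(\xi,v):v\text{ vertex of }P\}+\mathrm{tail}(P)$. *)

theory Defs
  imports "HOL-Analysis.Analysis"
begin

text \<open>
  A free abelian group \<open>N\<close> of finite rank is realised, together with
  \<open>N \<otimes> \<real>\<close>, inside a Euclidean space: \<open>N\<close> is the set of integral combinations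
  of a linearly independent set, and \<open>N \<otimes> \<real>\<close> is \<open>span N\<close>.  The ambient space may be
  larger than \<open>span N\<close>, so the rank is arbitrary (and may be 0); the inner product serves
  only to write down linear functionals.
\<close>

definition free_lattice :: "'a::euclidean_space set \<Rightarrow> bool" where
  "free_lattice N \<longleftrightarrow>
     (\<exists>B. independent B \<and> N = {\<Sum>b\<in>B. of_int (c b) *\<^sub>R b | c :: 'a \<Rightarrow> int. True})"

definition rational_polyhedron :: "'a::euclidean_space set \<Rightarrow> 'a set \<Rightarrow> bool" where
  "rational_polyhedron N P \<longleftrightarrow>
     (\<exists>H :: ('a \<times> real) set. finite H
        \<and> (\<forall>(a, b)\<in>H. (\<forall>x\<in>N. a \<bullet> x \<in> \<rat>) \<and> b \<in> \<rat>)
        \<and> P = {x \<in> span N. \<forall>(a, b)\<in>H. a \<bullet> x \<le> b})"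

definition tail_cone :: "'a::real_vector set \<Rightarrow> 'a set" where
  "tail_cone P = {a. (\<lambda>x. a + x) ` P \<subseteq> P}"

definition vertex_enum :: "'a::real_vector set \<Rightarrow> ('m::finite \<Rightarrow> 'a) \<Rightarrow> bool" where
  "vertex_enum P v \<longleftrightarrow> bij_betw v UNIV {x. x extreme_point_of P}"

text \<open>
  A compact edge is represented by the two-element set \<open>{i, j}\<close> of the indices of its
  endpoints; as a subset of the ambient space it is the segment \<open>edge_seg v {i, j}\<close>.
\<close>

definition compact_edges :: "'a::euclidean_space set \<Rightarrow> ('m::finite \<Rightarrow> 'a) \<Rightarrow> 'm set set" where
  "compact_edges P v = {{i, j} | i j. closed_segment (v i) (v j) edge_of P}"

definition edge_seg :: "('m \<Rightarrow> 'a::real_vector) \<Rightarrow> 'm set \<Rightarrow> 'a set" where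
  "edge_seg v d = convex hull (v ` d)"

definition compact_two_face :: "'a::euclidean_space set \<Rightarrow> 'a set \<Rightarrow> bool" where
  "compact_two_face P F \<longleftrightarrow> F face_of P \<and> aff_dim F = 2 \<and> compact F"

definition edges_in ::
  "'a::euclidean_space set \<Rightarrow> ('m::finite \<Rightarrow> 'a) \<Rightarrow> 'a set \<Rightarrow> 'm set set" where
  "edges_in P v F = {d \<in> compact_edges P v. edge_seg v d \<subseteq> F}"

text \<open>A chosen orientation \<open>ori d = (i, j)\<close> turns the edge \<open>d = {i, j}\<close> into \<open>v j - v i\<close>.\<close>

definition edge_orientation ::
  "'a::euclidean_space set \<Rightarrow> ('m::finite \<Rightarrow> 'a) \<Rightarrow> ('m set \<Rightarrow> 'm \<times> 'm) \<Rightarrow> bool" where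
  "edge_orientation P v ori \<longleftrightarrow> (\<forall>d\<in>compact_edges P v. {fst (ori d), snd (ori d)} = d)"

definition edge_vec ::
  "('m \<Rightarrow> 'a::real_vector) \<Rightarrow> ('m set \<Rightarrow> 'm \<times> 'm) \<Rightarrow> 'm set \<Rightarrow> 'a" where
  "edge_vec v ori d = v (snd (ori d)) - v (fst (ori d))"

text \<open>
  The list \<open>us\<close> runs once around the boundary of the polygon \<open>F\<close>: it lists the vertices of
  \<open>F\<close> without repetition, and cyclically consecutive vertices give exactly the edges of \<open>F\<close>.
\<close>

definition boundary_cycle ::
  "'a::euclidean_space set \<Rightarrow> ('m::finite \<Rightarrow> 'a) \<Rightarrow> 'a set \<Rightarrow> 'm list \<Rightarrow> bool" where
  "boundary_cycle P v F us \<longleftrightarrow>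
     distinct us \<and> set us = {i. v i \<in> F}
     \<and> edges_in P v F = {{us ! k, us ! (Suc k mod length us)} | k. k < length us}"

definition cycle_signs ::
  "'a::euclidean_space set \<Rightarrow> ('m::finite \<Rightarrow> 'a) \<Rightarrow> ('m set \<Rightarrow> 'm \<times> 'm)
     \<Rightarrow> ('a set \<Rightarrow> 'm set \<Rightarrow> real) \<Rightarrow> bool" where
  "cycle_signs P v ori eps \<longleftrightarrow>
     (\<forall>F. compact_two_face P F \<longrightarrow>
        (\<forall>d\<in>edges_in P v F. eps F d \<in> {1, -1})
        \<and> (\<exists>us. boundary_cycle P v F us
             \<and> (\<forall>k<length us.
                  eps F {us ! k, us ! (Suc k mod length us)}
                    *\<^sub>R edge_vec v ori {us ! k, us ! (Suc k mod length us)}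
                  = v (us ! (Suc k mod length us)) - v (us ! k))))"

definition half_open_segment :: "'a::real_vector \<Rightarrow> 'a \<Rightarrow> 'a set" where
  "half_open_segment x y = closed_segment x y - {y}"

definition least_multiple :: "'a::euclidean_space set \<Rightarrow> 'a \<Rightarrow> 'a \<Rightarrow> nat" where
  "least_multiple N x y =
     (LEAST g. g \<ge> 1 \<and> affine hull {real g *\<^sub>R x, real g *\<^sub>R y} \<inter> N \<noteq> {})"

definition short_half_open :: "'a::euclidean_space set \<Rightarrow> 'a \<Rightarrow> 'a \<Rightarrow> bool" where
  "short_half_open N x y \<longleftrightarrow>
     (let g = least_multiple N x y
      in card ((\<lambda>z. real g *\<^sub>R z) ` half_open_segment x y \<inter> N) \<le> g - 1)"

text \<open>
  With \<open>m\<close> vertices indexed by \<open>'m\<close>, the space \<open>\<real>\<^sup>r \<oplus> \<real>\<^sup>m\<close> is the subspace of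
  \<open>(real ^ 'm set) \<times> (real ^ 'm)\<close> in which the first component vanishes at every index
  that is not a compact edge (\<open>r\<close> may be 0, so compact edges cannot be indexed by a type).
  Thus \<open>t $ {i, j}\<close> is the coordinate \<open>t\<^sub>i\<^sub>j\<close>.
\<close>

definition T_space ::
  "'a::euclidean_space set \<Rightarrow> 'a set \<Rightarrow> ('m::finite \<Rightarrow> 'a) \<Rightarrow> ('m set \<Rightarrow> 'm \<times> 'm)
     \<Rightarrow> ('a set \<Rightarrow> 'm set \<Rightarrow> real) \<Rightarrow> ((real ^ 'm set) \<times> (real ^ 'm)) set" where
  "T_space N P v ori eps = {(t, s).
     (\<forall>d. d \<notin> compact_edges P v \<longrightarrow> t $ d = 0)
     \<and> (\<forall>F. compact_two_face P F \<longrightarrow>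
          (\<Sum>d\<in>edges_in P v F. (eps F d * t $ d) *\<^sub>R edge_vec v ori d) = 0)
     \<and> (\<forall>i. v i \<in> N \<longrightarrow> s $ i = 0)
     \<and> (\<forall>i j. {i, j} \<in> compact_edges P v \<and> closed_segment (v i) (v j) \<inter> N = {}
          \<longrightarrow> s $ i = s $ j)
     \<and> (\<forall>i j. {i, j} \<in> compact_edges P v \<and> short_half_open N (v i) (v j)
          \<longrightarrow> s $ i = t $ {i, j})}"

definition T_plus ::
  "'a::euclidean_space set \<Rightarrow> 'a set \<Rightarrow> ('m::finite \<Rightarrow> 'a) \<Rightarrow> ('m set \<Rightarrow> 'm \<times> 'm)
     \<Rightarrow> ('a set \<Rightarrow> 'm set \<Rightarrow> real) \<Rightarrow> ((real ^ 'm set) \<times> (real ^ 'm)) set" where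
  "T_plus N P v ori eps =
     T_space N P v ori eps \<inter> {(t, s). (\<forall>d. t $ d \<ge> 0) \<and> (\<forall>i. s $ i \<ge> 0)}"

definition edge_path ::
  "'a::euclidean_space set \<Rightarrow> ('m::finite \<Rightarrow> 'a) \<Rightarrow> 'm \<Rightarrow> 'm \<Rightarrow> 'm list \<Rightarrow> bool" where
  "edge_path P v i j us \<longleftrightarrow>
     us \<noteq> [] \<and> hd us = i \<and> last us = j
     \<and> (\<forall>k. Suc k < length us \<longrightarrow> {us ! k, us ! Suc k} \<in> compact_edges P v)"

text \<open>The point \<open>\<psi>(\<xi>, v)\<close> computed along the path \<open>us\<close> of vertex indices.\<close>

definition psi ::
  "('m::finite \<Rightarrow> 'a::real_vector) \<Rightarrow> (real ^ 'm set) \<times> (real ^ 'm) \<Rightarrow> 'm list \<Rightarrow> 'a" where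
  "psi v xi us = (snd xi $ hd us) *\<^sub>R v (hd us)
     + (\<Sum>k<length us - 1. (fst xi $ {us ! k, us ! Suc k}) *\<^sub>R (v (us ! Suc k) - v (us ! k)))"

text \<open>In the next two definitions \<open>pth xi i\<close> is the path chosen for \<open>\<xi>\<close> and the vertex \<open>v i\<close>.\<close>

definition P_fibre ::
  "'a::euclidean_space set \<Rightarrow> ('m::finite \<Rightarrow> 'a)
     \<Rightarrow> ((real ^ 'm set) \<times> (real ^ 'm) \<Rightarrow> 'm \<Rightarrow> 'm list)
     \<Rightarrow> (real ^ 'm set) \<times> (real ^ 'm) \<Rightarrow> 'a set" where
  "P_fibre P v pth xi =
     {x + a | x a. x \<in> convex hull (range (\<lambda>i. psi v xi (pth xi i))) \<and> a \<in> tail_cone P}"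

definition tautological_cone ::
  "'a::euclidean_space set \<Rightarrow> 'a set \<Rightarrow> ('m::finite \<Rightarrow> 'a) \<Rightarrow> ('m set \<Rightarrow> 'm \<times> 'm)
     \<Rightarrow> ('a set \<Rightarrow> 'm set \<Rightarrow> real)
     \<Rightarrow> ((real ^ 'm set) \<times> (real ^ 'm) \<Rightarrow> 'm \<Rightarrow> 'm list)
     \<Rightarrow> (((real ^ 'm set) \<times> (real ^ 'm)) \<times> 'a) set" where
  "tautological_cone N P v ori eps pth =
     {(xi, w). xi \<in> T_plus N P v ori eps \<and> w \<in> P_fibre P v pth xi}"

end

theory Submission
  imports Defs
begin

text \<open>
  The closing conditions at the compact 2-faces make \<open>\<psi>\<close> path independent. Take a generic
  functional \<open>c\<close> that is negative on the nonzero tail directions and build a potential for the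
  edge vectors \<open>t d\<close> downwards along \<open>c\<close>. At a new vertex \<open>v\<close> it must be shown that all edges
  increasing \<open>c\<close> prescribe the same value. If such an edge does not have maximal slope in the
  vertex figure, then a 2-face contains it together with a steeper edge at \<open>v\<close>; \<open>v\<close> is the
  \<open>c\<close>-minimum of this face, so the face is compact, and its closing condition compares the two
  values. Hence all values agree with that of the steepest edge.

  Thus \<open>\<psi>(\<xi>, v)\<close> is linear in \<open>\<xi>\<close>. If \<open>c\<close> attains its maximum over \<open>P\<close> at \<open>v\<close>, then, by following
  \<open>c\<close>-increasing edges and using \<open>t \<ge> 0\<close>, it attains its maximum over \<open>P\<^sub>\<xi>\<close> at \<open>\<psi>(\<xi>, v)\<close>.
  With Farkas' lemma it follows that \<open>P\<^sub>\<xi>\<close> is cut out by the inequalities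
  \<open>a \<bullet> w \<le> a \<bullet> \<psi>(\<xi>, v)\<close>, where \<open>a \<bullet> x \<le> b\<close> runs through the inequalities of \<open>P\<close> and \<open>v\<close> through
  the vertices at which it is tight. These are finitely many linear inequalities in \<open>(\<xi>, w)\<close>.
\<close>

section \<open>Increasing edges and faces of polyhedra\<close>

lemma polyhedron_inequalities:
  fixes P :: "'a::euclidean_space set"
  assumes "polyhedron P"
  obtains H :: "('a \<times> real) set" where "finite H" "P = {x. \<forall>(a, b)\<in>H. a \<bullet> x \<le> b}"
proof -
  obtain F where F: "finite F" "P = \<Inter> F" "\<forall>h\<in>F. \<exists>a b. h = {x. a \<bullet> x \<le> b}"
    using assms unfolding polyhedron_def by metis
  then obtain A B where AB: "\<And>h. h \<in> F \<Longrightarrow> h = {x. A h \<bullet> x \<le> B h}"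
    by metis
  have "P = {x. \<forall>(a, b)\<in>(\<lambda>h. (A h, B h)) ` F. a \<bullet> x \<le> b}"
    unfolding F(2) using AB by auto
  with F(1) show thesis
    by (intro that[of "(\<lambda>h. (A h, B h)) ` F"]) auto
qed

text \<open>A constraint inactive at \<open>p\<close> has positive slack and survives a short step
  in any direction; an active one is preserved because \<open>z\<close> does not increase it.
  Finitely many constraints leave a common step length.\<close>

lemma feasible_direction:
  fixes p z :: "'a::real_inner"
  assumes "finite H" and P: "P = {x. \<forall>(a, b)\<in>H. a \<bullet> x \<le> b}" and "p \<in> P"
    and active: "\<And>a b. (a, b) \<in> H \<Longrightarrow> a \<bullet> p = b \<Longrightarrow> a \<bullet> z \<le> 0"
  obtains e where "e > 0" "\<And>s. 0 \<le> s \<Longrightarrow> s \<le> e \<Longrightarrow> p + s *\<^sub>R z \<in> P"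
proof -
  have "\<exists>e>0. \<forall>s. 0 \<le> s \<and> s \<le> e \<longrightarrow> a \<bullet> (p + s *\<^sub>R z) \<le> b" if "(a, b) \<in> H" for a b
  proof (cases "a \<bullet> p = b")
    case True
    with active[OF that] have "a \<bullet> (p + s *\<^sub>R z) \<le> b" if "0 \<le> s" for s
      using that by (simp add: inner_add_right mult_nonneg_nonpos)
    then show ?thesis
      by (intro exI[of _ 1]) auto
  next
    case False
    then have pb: "a \<bullet> p < b"
      using \<open>p \<in> P\<close> that P by fastforce
    \<comment> \<open>The summand 1 keeps the denominator positive when
      \<open>a \<bullet> z = 0\<close>.\<close>
    define e where "e = (b - a \<bullet> p) / (\<bar>a \<bullet> z\<bar> + 1)"
    have "e > 0"
      using pb by (simp add: e_def)
    moreover have "a \<bullet> (p + s *\<^sub>R z) \<le> b" if s: "0 \<le> s" "s \<le> e" for s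
    proof -
      have "s * (a \<bullet> z) \<le> s * (\<bar>a \<bullet> z\<bar> + 1)"
        using s by (intro mult_left_mono) auto
      also have "\<dots> \<le> e * (\<bar>a \<bullet> z\<bar> + 1)"
        using s by (intro mult_right_mono) auto
      also have "\<dots> = b - a \<bullet> p"
        by (simp add: e_def)
      finally show ?thesis
        by (simp add: inner_add_right)
    qed
    ultimately show ?thesis
      by blast
  qed
  then have "\<forall>h\<in>H. \<exists>e>0. \<forall>s. 0 \<le> s \<and> s \<le> e \<longrightarrow> fst h \<bullet> (p + s *\<^sub>R z) \<le> snd h"
    by auto
  then obtain e where e: "\<And>h. h \<in> H \<Longrightarrow> e h > 0"
      "\<And>h s. h \<in> H \<Longrightarrow> 0 \<le> s \<Longrightarrow> s \<le> e h \<Longrightarrow> fst h \<bullet> (p + s *\<^sub>R z) \<le> snd h"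
    by metis
  define e0 where "e0 = Min (insert 1 (e ` H))"
  have "e0 > 0"
    unfolding e0_def using \<open>finite H\<close> e(1) by (subst Min_gr_iff) auto
  moreover have "p + s *\<^sub>R z \<in> P" if "0 \<le> s" "s \<le> e0" for s
  proof -
    have "s \<le> e h" if "h \<in> H" for h
      using that \<open>s \<le> e0\<close> \<open>finite H\<close> unfolding e0_def by (subst (asm) Min_ge_iff) auto
    with e(2) \<open>0 \<le> s\<close> have "fst h \<bullet> (p + s *\<^sub>R z) \<le> snd h" if "h \<in> H" for h
      using that by blast
    then show ?thesis
      unfolding P by fastforce
  qed
  ultimately show thesis
    by (rule that)
qed

text \<open>Having more than one dimension above \<open>D\<close> leaves room to tilt the direction
  \<open>x - p\<close> without changing its \<open>c\<close>-value, until it meets the boundary of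
  the tangent cone at a relative interior point \<open>p\<close> of \<open>D\<close>. A constraint
  that becomes tight there cuts out the face.\<close>

lemma larger_proper_face:
  fixes P :: "'a::euclidean_space set"
  assumes "polyhedron P" and D: "D face_of P" "D \<noteq> {}" "\<And>y. y \<in> D \<Longrightarrow> c \<bullet> y = \<gamma>"
    and x: "x \<in> P" "c \<bullet> x > \<gamma>" and dim: "aff_dim P > aff_dim D + 1"
  obtains F where "F face_of P" "F \<noteq> P" "D \<subseteq> F" "\<exists>x'\<in>F. c \<bullet> x' > \<gamma>"
proof -
  obtain H where H: "finite H" "P = {x. \<forall>(a, b)\<in>H. a \<bullet> x \<le> b}"
    using polyhedron_inequalities[OF \<open>polyhedron P\<close>] by blast
  have "convex P"
    by (simp add: \<open>polyhedron P\<close> polyhedron_imp_convex)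
  have "convex D" "D \<subseteq> P"
    using D(1) face_of_imp_convex face_of_imp_subset by blast+
  then obtain p where p: "p \<in> rel_interior D"
    using D(2) rel_interior_eq_empty by blast
  then have pD: "p \<in> D" and pP: "p \<in> P"
    using rel_interior_subset \<open>D \<subseteq> P\<close> by auto
  have "\<not> P \<subseteq> affine hull (insert x D)"
  proof
    assume "P \<subseteq> affine hull (insert x D)"
    then have "aff_dim P \<le> aff_dim (insert x D)"
      by (metis aff_dim_affine_hull aff_dim_subset)
    also have "\<dots> \<le> aff_dim D + 1"
      by (simp add: aff_dim_insert)
    finally show False
      using dim by simp
  qed
  then obtain y where y: "y \<in> P" "y \<notin> affine hull (insert x D)"
    by blast
  have cxp: "c \<bullet> (x - p) > 0"
    using x D(3)[OF pD] by (simp add: inner_diff_right)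
  define r where "r = (c \<bullet> (y - p)) / (c \<bullet> (x - p))"
  \<comment> \<open>Starting from \<open>x - p\<close> in the tangent cone of \<open>P\<close> at \<open>p\<close>, move in a direction that keeps \<open>c\<close>
    and is transversal to \<open>D\<close> until a constraint active at \<open>p\<close> becomes tight.\<close>
  define d0 where "d0 = (y - p) - r *\<^sub>R (x - p)"
  have cd0: "c \<bullet> d0 = 0"
    using cxp by (simp add: d0_def r_def inner_diff_right)
  \<comment> \<open>If all constraints active at \<open>p\<close> were constant along
    \<open>d0\<close>, then \<open>P\<close> would contain a segment with midpoint \<open>p\<close>
    in direction \<open>d0\<close>. The face \<open>D\<close> would contain this segment too, which
    puts \<open>y\<close> into the affine hull of \<open>x\<close> and \<open>D\<close>.\<close>
  have "\<exists>h\<in>H. fst h \<bullet> p = snd h \<and> fst h \<bullet> d0 \<noteq> 0"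
  proof (rule ccontr)
    assume "\<not> ?thesis"
    then have z: "\<And>a b. (a, b) \<in> H \<Longrightarrow> a \<bullet> p = b \<Longrightarrow> a \<bullet> d0 = 0"
      by fastforce
    obtain e1 where e1: "e1 > 0" "\<And>s. 0 \<le> s \<Longrightarrow> s \<le> e1 \<Longrightarrow> p + s *\<^sub>R d0 \<in> P"
      by (rule feasible_direction[OF H pP, of d0]) (auto simp: z)
    obtain e2 where e2: "e2 > 0" "\<And>s. 0 \<le> s \<Longrightarrow> s \<le> e2 \<Longrightarrow> p + s *\<^sub>R (- d0) \<in> P"
      by (rule feasible_direction[OF H pP, of "- d0"]) (auto simp: z)
    define e where "e = min e1 e2"
    have e: "e > 0" "p + e *\<^sub>R d0 \<in> P" "p - e *\<^sub>R d0 \<in> P"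
      using e1 e2(1) e2(2)[of e] by (auto simp: e_def)
    have "p + e *\<^sub>R d0 \<in> D"
    proof (cases "d0 = 0")
      case True
      then show ?thesis using pD by simp
    next
      case False
      have "p = midpoint (p + e *\<^sub>R d0) (p - e *\<^sub>R d0)"
        by (simp add: midpoint_def flip: scaleR_2)
      moreover have "p + e *\<^sub>R d0 \<noteq> p - e *\<^sub>R d0"
        using False e(1) by (simp add: eq_neg_iff_add_eq_0 flip: scaleR_2)
      ultimately have "p \<in> open_segment (p + e *\<^sub>R d0) (p - e *\<^sub>R d0)"
        by (metis midpoint_in_open_segment)
      then show ?thesis
        using face_ofD[OF D(1)] e pD by blast
    qed
    then have "(1 - 1/e) *\<^sub>R p + (1/e) *\<^sub>R (p + e *\<^sub>R d0) \<in> affine hull D"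
      using pD by (intro mem_affine[OF affine_affine_hull]) (auto intro: hull_inc)
    moreover have "(1 - 1/e) *\<^sub>R p + (1/e) *\<^sub>R (p + e *\<^sub>R d0) = p + d0"
      using e(1) by (simp add: algebra_simps)
    ultimately have pd: "p + d0 \<in> affine hull (insert x D)"
      by (metis hull_mono subset_insertI subsetD)
    have "1 *\<^sub>R (p + d0) + r *\<^sub>R x + (- r) *\<^sub>R p \<in> affine hull (insert x D)"
      using pd pD by (intro mem_affine_3[OF affine_affine_hull]) (auto intro: hull_inc)
    moreover have "1 *\<^sub>R (p + d0) + r *\<^sub>R x + (- r) *\<^sub>R p = y"
      by (simp add: d0_def algebra_simps)
    ultimately show False
      using y by simp
  qed
  then obtain h0 where h0: "h0 \<in> H" "fst h0 \<bullet> p = snd h0" "fst h0 \<bullet> d0 \<noteq> 0"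
    by blast
  define d where "d = (if fst h0 \<bullet> d0 > 0 then d0 else - d0)"
  have cd: "c \<bullet> d = 0" and h0d: "fst h0 \<bullet> d > 0"
    using cd0 h0(3) by (auto simp: d_def)
  \<comment> \<open>\<open>d\<close> is a combination of differences of points of \<open>P\<close>,
    so functionals constant on \<open>P\<close> vanish on it. This makes the face found below
    proper, since its constraint is positive on \<open>d\<close>.\<close>
  have const: "a \<bullet> d = 0" if "\<And>u. u \<in> P \<Longrightarrow> a \<bullet> u = b" for a b
    using that[OF y(1)] that[OF x(1)] that[OF pP] by (auto simp: d_def d0_def inner_diff_right)
  define A where "A = {h \<in> H. fst h \<bullet> p = snd h \<and> fst h \<bullet> d > 0}"
  \<comment> \<open>\<open>R h\<close> is the time at which the constraint \<open>h\<close> becomes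
    tight along \<open>x - p + s *\<^sub>R d\<close>; the minimum over \<open>A\<close> is the first
    hit.\<close>
  define R where "R h = - (fst h \<bullet> (x - p)) / (fst h \<bullet> d)" for h :: "'a \<times> real"
  have A: "finite A" "h0 \<in> A"
    using H(1) h0 h0d by (auto simp: A_def)
  define h1 where "h1 = arg_min_on R A"
  have h1: "h1 \<in> A" "\<And>h. h \<in> A \<Longrightarrow> R h1 \<le> R h"
    using arg_min_if_finite[OF A(1), of R] A(2) arg_min_least[OF A(1)] unfolding h1_def by auto
  have xle: "fst h \<bullet> (x - p) \<le> 0" if "h \<in> H" "fst h \<bullet> p = snd h" for h
    using x(1) that unfolding H(2) by (auto simp: inner_diff_right)
  have R0: "R h1 \<ge> 0"
    using h1(1) xle[of h1] by (auto simp: R_def A_def divide_nonpos_pos)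
  define z where "z = (x - p) + R h1 *\<^sub>R d"
  have cz: "c \<bullet> z > 0"
    using cxp cd by (simp add: z_def inner_add_right)
  have z0: "fst h1 \<bullet> z = 0"
    using h1(1) by (auto simp: z_def R_def inner_diff_right inner_add_right A_def)
  have zle: "a \<bullet> z \<le> 0" if ab: "(a, b) \<in> H" "a \<bullet> p = b" for a b
  proof (cases "a \<bullet> d > 0")
    case True
    then have "(a, b) \<in> A"
      using ab by (simp add: A_def)
    then have "R h1 \<le> - (a \<bullet> (x - p)) / (a \<bullet> d)"
      using h1(2)[of "(a, b)"] by (simp add: R_def)
    then show ?thesis
      using True by (simp add: z_def inner_add_right inner_diff_right pos_le_divide_eq)
  next
    case False
    then have "R h1 * (a \<bullet> d) \<le> 0"
      using R0 by (simp add: mult_nonneg_nonpos)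
    then show ?thesis
      using xle[of "(a, b)"] ab by (simp add: z_def inner_add_right)
  qed
  obtain e where e: "e > 0" "\<And>s. 0 \<le> s \<Longrightarrow> s \<le> e \<Longrightarrow> p + s *\<^sub>R z \<in> P"
    by (rule feasible_direction[OF H pP, of z]) (auto simp: zle)
  define F where "F = P \<inter> {u. fst h1 \<bullet> u = snd h1}"
  have h1H: "h1 \<in> H" "fst h1 \<bullet> p = snd h1" "fst h1 \<bullet> d > 0"
    using h1(1) by (auto simp: A_def)
  have F: "F face_of P"
    unfolding F_def using \<open>convex P\<close> h1H(1) H(2)
    by (intro face_of_Int_supporting_hyperplane_le) auto
  moreover have "F \<noteq> P"
    using const[of "fst h1" "snd h1"] h1H(3) by (auto simp: F_def)
  moreover have "p \<in> F"
    using pP h1H by (simp add: F_def)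
  \<comment> \<open>A face that meets the relative interior of \<open>D\<close> contains
    \<open>D\<close>; this is why \<open>p\<close> was taken there.\<close>
  then have "D \<subseteq> F"
    using subset_of_face_of[OF F \<open>D \<subseteq> P\<close>] p by blast
  moreover have "p + e *\<^sub>R z \<in> F"
    using e h1H z0 by (simp add: F_def inner_add_right)
  then have "\<exists>x'\<in>F. c \<bullet> x' > \<gamma>"
    using cz e(1) D(3)[OF pD] by (intro bexI[of _ "p + e *\<^sub>R z"]) (auto simp: inner_add_right)
  ultimately show thesis
    by (rule that)
qed

text \<open>Descending through the proper faces of \<open>larger_proper_face\<close> lowers the
  dimension while keeping \<open>D\<close> and a point of larger \<open>c\<close>-value. The descent
  stops exactly one dimension above \<open>D\<close>.\<close>

lemma increasing_face:
  fixes P :: "'a::euclidean_space set"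
  assumes "polyhedron P" and "D face_of P" "D \<noteq> {}" "\<And>y. y \<in> D \<Longrightarrow> c \<bullet> y = \<gamma>"
    and "x \<in> P" "c \<bullet> x > \<gamma>"
  obtains F where "F face_of P" "D \<subseteq> F" "aff_dim F = aff_dim D + 1" "\<exists>x'\<in>F. c \<bullet> x' > \<gamma>"
proof -
  have "\<exists>F. F face_of P \<and> D \<subseteq> F \<and> aff_dim F = aff_dim D + 1 \<and> (\<exists>x'\<in>F. c \<bullet> x' > \<gamma>)"
    using assms
  proof (induction "nat (aff_dim P + 1)" arbitrary: P x rule: less_induct)
    case less
    have "convex P"
      by (simp add: less.prems(1) polyhedron_imp_convex)
    have "D \<noteq> P"
      using less.prems(4-6) by fastforce
    then have lt: "aff_dim D < aff_dim P"
      using face_of_aff_dim_lt[OF \<open>convex P\<close>] less.prems by blast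
    show ?case
    proof (cases "aff_dim P = aff_dim D + 1")
      case True
      then show ?thesis
        using less.prems face_of_refl[OF \<open>convex P\<close>] face_of_imp_subset by blast
    next
      case False
      then have "aff_dim P > aff_dim D + 1"
        using lt by simp
      then obtain F x' where F: "F face_of P" "F \<noteq> P" "D \<subseteq> F" "x' \<in> F" "c \<bullet> x' > \<gamma>"
        using larger_proper_face[OF less.prems(1-6)] by metis
      have "aff_dim F < aff_dim P"
        using face_of_aff_dim_lt[OF \<open>convex P\<close>] F by blast
      moreover have "aff_dim F \<ge> -1"
        by (simp add: aff_dim_geq)
      ultimately have "nat (aff_dim F + 1) < nat (aff_dim P + 1)"
        by linarith
      moreover have "polyhedron F"
        using F less.prems(1) face_of_polyhedron_polyhedron by blast
      moreover have "D face_of F"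
        using F less.prems(2) by (meson face_of_face)
      ultimately obtain G where "G face_of F" "D \<subseteq> G" "aff_dim G = aff_dim D + 1" "\<exists>x'\<in>G. c \<bullet> x' > \<gamma>"
        using less.hyps[of F x'] less.prems(3,4) F by blast
      then show ?thesis
        using F face_of_trans by blast
    qed
  qed
  then show thesis
    using that by blast
qed

text \<open>A functional exposing \<open>v\<close> is negative on the tangent cone away from 0,
  hence by compactness of the unit sphere at most a negative multiple of the norm. This margin
  survives a small perturbation, which can avoid the hyperplanes orthogonal to the elements of
  \<Delta>. Later the margin bounds faces, and the avoided hyperplanes make orderings of vertices
  and edges strict.\<close>

lemma generic_exposing_functional:
  fixes P :: "'a::euclidean_space set"
  assumes "polyhedron P" and v: "v extreme_point_of P" and \<Delta>: "finite \<Delta>" "0 \<notin> \<Delta>"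
  obtains h \<eta> where "\<eta> > 0" "\<And>x. x \<in> P \<Longrightarrow> h \<bullet> (x - v) \<le> - \<eta> * norm (x - v)"
    "\<And>\<delta>. \<delta> \<in> \<Delta> \<Longrightarrow> h \<bullet> \<delta> \<noteq> 0"
proof -
  obtain H where H: "finite H" "P = {x. \<forall>(a, b)\<in>H. a \<bullet> x \<le> b}"
    using polyhedron_inequalities[OF \<open>polyhedron P\<close>] by blast
  have "v \<in> P"
    using v by (simp add: extreme_point_of_def)
  have "{v} exposed_face_of P"
    using v exposed_face_of_polyhedron[OF \<open>polyhedron P\<close>] by (simp add: face_of_singleton)
  then have "P = {v} \<or> (\<exists>a b. P \<subseteq> {x. a \<bullet> x \<le> b} \<and> {v} = P \<inter> {x. a \<bullet> x = b})"
    unfolding exposed_face_of by blast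
  then obtain a where a: "\<And>x. x \<in> P \<Longrightarrow> x \<noteq> v \<Longrightarrow> a \<bullet> x < a \<bullet> v"
  proof
    assume "P = {v}"
    then show thesis
      using that by blast
  next
    assume "\<exists>a b. P \<subseteq> {x. a \<bullet> x \<le> b} \<and> {v} = P \<inter> {x. a \<bullet> x = b}"
    then obtain a b where ab: "P \<subseteq> {x. a \<bullet> x \<le> b}" "{v} = P \<inter> {x. a \<bullet> x = b}"
      by blast
    have "a \<bullet> v = b"
      using ab(2) by blast
    moreover have "a \<bullet> x \<le> b" "a \<bullet> x \<noteq> b" if "x \<in> P" "x \<noteq> v" for x
      using ab that by blast+
    ultimately show thesis
      using that[of a] by fastforce
  qed
  \<comment> \<open>The tangent cone of \<open>P\<close> at \<open>v\<close>: a short multiple of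
    any of its elements leads from \<open>v\<close> into \<open>P\<close>.\<close>
  define K where "K = {z. \<forall>h\<in>H. fst h \<bullet> v = snd h \<longrightarrow> fst h \<bullet> z \<le> 0}"
  have "K = (\<Inter>h\<in>{h \<in> H. fst h \<bullet> v = snd h}. {z. fst h \<bullet> z \<le> 0})"
    by (auto simp: K_def)
  then have "closed K"
    by (simp add: closed_INT closed_halfspace_le)
  have PK: "x - v \<in> K" if "x \<in> P" for x
    using that unfolding H(2) K_def by (auto simp: inner_diff_right)
  have K_scale: "r *\<^sub>R z \<in> K" if "z \<in> K" "r \<ge> 0" for z r
    using that unfolding K_def by (auto simp: mult_nonneg_nonpos)
  have aK: "a \<bullet> z < 0" if z: "z \<in> K" "z \<noteq> 0" for z
  proof -
    obtain e where "e > 0" "\<And>s. 0 \<le> s \<Longrightarrow> s \<le> e \<Longrightarrow> v + s *\<^sub>R z \<in> P"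
      by (rule feasible_direction[OF H \<open>v \<in> P\<close>, of z]) (use z(1) in \<open>auto simp: K_def\<close>)
    then have "v + e *\<^sub>R z \<in> P"
      by simp
    then have "a \<bullet> (v + e *\<^sub>R z) < a \<bullet> v"
      using a \<open>e > 0\<close> z(2) by simp
    then show ?thesis
      using \<open>e > 0\<close> by (simp add: inner_add_right mult_less_0_iff)
  qed
  obtain \<eta> where \<eta>: "\<eta> > 0" "\<And>z. z \<in> K \<Longrightarrow> norm z = 1 \<Longrightarrow> a \<bullet> z \<le> - \<eta>"
  proof (cases "K \<inter> sphere 0 1 = {}")
    \<comment> \<open>Here the tangent cone is 0, so every positive constant will do.\<close>
    case True
    then show thesis
      by (intro that[of 1]) auto
  next
    case False
    have "compact (K \<inter> sphere 0 1)"
      using \<open>closed K\<close> by (simp add: closed_Int_compact)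
    moreover have "continuous_on (K \<inter> sphere 0 1) (\<lambda>z. a \<bullet> z)"
      by (intro continuous_intros)
    ultimately obtain z0 where z0: "z0 \<in> K \<inter> sphere 0 1" "\<And>z. z \<in> K \<inter> sphere 0 1 \<Longrightarrow> a \<bullet> z \<le> a \<bullet> z0"
      using continuous_attains_sup[of "K \<inter> sphere 0 1" "\<lambda>z. a \<bullet> z"] False by blast
    then have "z0 \<in> K" "z0 \<noteq> 0"
      by auto
    then show thesis
      using aK[of z0] that[of "- (a \<bullet> z0)"] z0 by auto
  qed
  have aK': "a \<bullet> z \<le> - \<eta> * norm z" if "z \<in> K" for z
  proof (cases "z = 0")
    case False
    have "a \<bullet> ((1 / norm z) *\<^sub>R z) \<le> - \<eta>"
      using False that by (intro \<eta>(2) K_scale) auto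
    then show ?thesis
      using False by (simp add: field_simps)
  qed simp
  \<comment> \<open>Finitely many hyperplanes have measure zero and cannot cover a ball around
    \<open>a\<close>.\<close>
  have "negligible (\<Union>\<delta>\<in>\<Delta>. {h. \<delta> \<bullet> h = 0})"
    using \<Delta> by (intro negligible_Union) (auto intro!: negligible_hyperplane)
  moreover have "\<not> negligible (ball a (\<eta> / 2))"
    using \<eta>(1) by (intro open_not_negligible) auto
  ultimately have "\<not> ball a (\<eta> / 2) \<subseteq> (\<Union>\<delta>\<in>\<Delta>. {h. \<delta> \<bullet> h = 0})"
    using negligible_subset by blast
  then obtain h where h': "h \<in> ball a (\<eta> / 2)" "h \<notin> (\<Union>\<delta>\<in>\<Delta>. {h. \<delta> \<bullet> h = 0})"
    by blast
  have h: "norm (a - h) < \<eta> / 2" "\<And>\<delta>. \<delta> \<in> \<Delta> \<Longrightarrow> h \<bullet> \<delta> \<noteq> 0"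
    using h' by (auto simp: dist_norm inner_commute)
  show thesis
  proof (rule that[of "\<eta> / 2" h])
    show "\<eta> / 2 > 0"
      using \<eta> by simp
    show "h \<bullet> (x - v) \<le> - (\<eta> / 2) * norm (x - v)" if "x \<in> P" for x
    proof -
      have "h \<bullet> (x - v) = a \<bullet> (x - v) + (h - a) \<bullet> (x - v)"
        by (simp add: inner_diff_left)
      also have "(h - a) \<bullet> (x - v) \<le> norm (h - a) * norm (x - v)"
        by (rule norm_cauchy_schwarz)
      also have "\<dots> \<le> (\<eta> / 2) * norm (x - v)"
        using h(1) by (intro mult_right_mono) (auto simp: norm_minus_commute)
      finally show ?thesis
        using aK'[OF PK[OF that]] by simp
    qed
    show "h \<bullet> \<delta> \<noteq> 0" if "\<delta> \<in> \<Delta>" for \<delta>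
      using h(2) that by blast
  qed
qed

section \<open>Recession directions and increasing compact edges\<close>

lemma ray_inequality:
  fixes P :: "'a::real_inner set"
  assumes P: "P = {x. \<forall>(a, b)\<in>H. a \<bullet> x \<le> b}" and ray: "\<And>M. \<exists>s>M. x + s *\<^sub>R u \<in> P"
    and ab: "(a, b) \<in> H"
  shows "a \<bullet> u \<le> 0"
proof (rule ccontr)
  assume "\<not> ?thesis"
  then have pos: "a \<bullet> u > 0"
    by simp
  obtain s where s: "s > (b - a \<bullet> x) / (a \<bullet> u)" "x + s *\<^sub>R u \<in> P"
    using ray by blast
  have "a \<bullet> (x + s *\<^sub>R u) \<le> b"
    using s(2) ab unfolding P by blast
  then show False
    using s(1) pos by (simp add: inner_add_right field_simps)
qed

lemma tail_cone_multiple: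
  assumes "u \<in> tail_cone F" "x \<in> F"
  shows "x + real n *\<^sub>R u \<in> F"
proof (induction n)
  case (Suc n)
  then have "u + (x + real n *\<^sub>R u) \<in> F"
    using assms(1) unfolding tail_cone_def by blast
  then show ?case
    by (simp add: algebra_simps)
qed (simp add: assms(2))

text \<open>Points arbitrarily far out in direction \<open>u\<close> suffice, not a whole ray. So
  integer translates can supply the hypothesis, and its negation is directly a bound on the length
  of an edge.\<close>

lemma tail_cone_of_ray:
  fixes P :: "'a::euclidean_space set"
  assumes "polyhedron P" and ray: "\<And>M. \<exists>s>M. x + s *\<^sub>R u \<in> P"
  shows "u \<in> tail_cone P"
proof -
  obtain H where H: "finite H" "P = {x. \<forall>(a, b)\<in>H. a \<bullet> x \<le> b}"
    using polyhedron_inequalities[OF \<open>polyhedron P\<close>] by blast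
  have "a \<bullet> u \<le> 0" if "(a, b) \<in> H" for a b
    by (rule ray_inequality[OF H(2) ray that])
  then show ?thesis
    unfolding tail_cone_def H(2) by (force simp: inner_add_right)
qed

text \<open>\<open>increasing_face\<close> with \<open>D = {v}\<close> gives a one-dimensional face
  \<open>E\<close>. It cannot pass through \<open>v\<close> to the other side because
  \<open>v\<close> is extreme, and it cannot be unbounded on the side of \<open>x'\<close>, where
  \<open>c\<close> increases, by the condition on the tail cone. Hence it is a segment starting at
  \<open>v\<close>.\<close>

lemma increasing_edge:
  fixes P :: "'a::euclidean_space set"
  assumes "polyhedron P" and v: "v extreme_point_of P"
    and tail: "\<And>u. u \<in> tail_cone P \<Longrightarrow> c \<bullet> u \<le> 0"
    and x: "x \<in> P" "c \<bullet> x > c \<bullet> v"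
  obtains w where "w extreme_point_of P" "closed_segment v w edge_of P" "c \<bullet> w > c \<bullet> v"
proof -
  obtain E where E: "E face_of P" "v \<in> E" "aff_dim E = 1" and "\<exists>x'\<in>E. c \<bullet> x' > c \<bullet> v"
    using increasing_face[OF \<open>polyhedron P\<close>, of "{v}" c "c \<bullet> v" x] v x
    by (auto simp: face_of_singleton)
  then obtain x' where x': "x' \<in> E" "c \<bullet> x' > c \<bullet> v"
    by blast
  have "x' \<noteq> v"
    using x'(2) by auto
  have vE: "v extreme_point_of E"
    using extreme_point_of_face[OF E(1)] v E(2) by blast
  have Ehull: "E \<subseteq> affine hull {v, x'}"
  proof -
    have "aff_dim {v, x'} = 1"
      using \<open>x' \<noteq> v\<close> by (simp add: aff_dim_2)
    then have "affine hull {v, x'} = affine hull E"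
      using aff_dim_eq_full_gen[of "{v, x'}" E] E x'(1) by auto
    then show ?thesis
      by (simp add: hull_subset)
  qed
  have pos: "s \<ge> 0" if "v + s *\<^sub>R (x' - v) \<in> E" for s
  proof (rule ccontr)
    assume s: "\<not> s \<ge> 0"
    \<comment> \<open>Chosen so that the coefficients of \<open>x' - v\<close> cancel and
      \<open>v\<close> lies strictly between \<open>x'\<close> and the point with negative
      parameter.\<close>
    define r where "r = 1 / (1 - s)"
    have r: "0 < r" "r < 1" "(1 - r) * 1 + r * s = 0"
      using s by (auto simp: r_def field_simps)
    have "v = (1 - r) *\<^sub>R x' + r *\<^sub>R (v + s *\<^sub>R (x' - v))"
    proof -
      have "(1 - r) *\<^sub>R x' + r *\<^sub>R (v + s *\<^sub>R (x' - v)) = v + ((1 - r) * 1 + r * s) *\<^sub>R (x' - v)"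
        by (simp add: algebra_simps)
      then show ?thesis
        using r(3) by simp
    qed
    then have "v \<in> open_segment x' (v + s *\<^sub>R (x' - v))"
      using r s \<open>x' \<noteq> v\<close> unfolding in_segment by auto
    then show False
      using vE that x'(1) unfolding extreme_point_of_def by blast
  qed
  have "bounded E"
  proof -
    have "\<exists>M. \<forall>s>M. v + s *\<^sub>R (x' - v) \<notin> P"
    proof (rule ccontr)
      assume "\<not> ?thesis"
      then have "x' - v \<in> tail_cone P"
        using tail_cone_of_ray[OF \<open>polyhedron P\<close>] by blast
      then show False
        using tail x'(2) by (fastforce simp: inner_diff_right)
    qed
    then obtain M where M: "\<And>s. v + s *\<^sub>R (x' - v) \<in> P \<Longrightarrow> s \<le> M"
      by (meson not_le)
    have "E \<subseteq> (\<lambda>s. v + s *\<^sub>R (x' - v)) ` {0..M}"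
    proof
      fix y assume "y \<in> E"
      then obtain s where s: "y = v + s *\<^sub>R (x' - v)"
        using Ehull unfolding affine_hull_2_alt by auto
      with \<open>y \<in> E\<close> have "0 \<le> s" "s \<le> M"
        using pos M E(1) face_of_imp_subset by blast+
      then show "y \<in> (\<lambda>s. v + s *\<^sub>R (x' - v)) ` {0..M}"
        using s by auto
    qed
    moreover have "compact ((\<lambda>s. v + s *\<^sub>R (x' - v)) ` {0..M})"
      by (intro compact_continuous_image continuous_intros) auto
    ultimately show ?thesis
      using bounded_subset compact_imp_bounded by blast
  qed
  moreover have "closed E" "convex E"
    using E(1) \<open>polyhedron P\<close> by (auto dest: face_of_polyhedron_polyhedron polyhedron_imp_closed polyhedron_imp_convex)
  moreover have "collinear E"
    using E(3) by (simp add: collinear_aff_dim)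
  ultimately obtain a b where ab: "E = closed_segment a b"
    using compact_convex_collinear_segment[of E] E(2) by (auto simp: compact_eq_bounded_closed)
  then have "v = a \<or> v = b"
    using vE by (simp add: extreme_point_of_segment)
  then obtain w where w: "E = closed_segment v w"
    using ab by (auto simp: closed_segment_commute)
  show thesis
  proof
    have "w extreme_point_of E"
      by (simp add: w extreme_point_of_segment)
    then show "w extreme_point_of P"
      using extreme_point_of_face[OF E(1)] by blast
    show "closed_segment v w edge_of P"
      using E w by (simp add: edge_of_def)
    obtain s where "x' = v + s *\<^sub>R (w - v)" "0 \<le> s" "s \<le> 1"
      using x'(1) unfolding w in_segment by (force simp: algebra_simps)
    then have "s * (c \<bullet> (w - v)) > 0"
      using x'(2) by (simp add: inner_add_right)
    then show "c \<bullet> w > c \<bullet> v"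
      using \<open>0 \<le> s\<close> by (simp add: zero_less_mult_iff inner_diff_right)
  qed
qed

lemma tail_cone_mono:
  fixes P :: "'a::euclidean_space set"
  assumes "polyhedron P" "F \<subseteq> P" "F \<noteq> {}"
  shows "tail_cone F \<subseteq> tail_cone P"
proof
  fix u assume u: "u \<in> tail_cone F"
  obtain x where x: "x \<in> F"
    using assms by blast
  show "u \<in> tail_cone P"
  proof (rule tail_cone_of_ray[OF \<open>polyhedron P\<close>])
    fix M
    obtain n where "M < real n"
      using reals_Archimedean2 by blast
    then show "\<exists>s>M. x + s *\<^sub>R u \<in> P"
      using tail_cone_multiple[OF u x] \<open>F \<subseteq> P\<close> by blast
  qed
qed

text \<open>In the plane of \<open>F\<close> the vectors \<open>w - v\<close> and
  \<open>w' - v\<close> form a basis. Each edge is exposed by a supporting hyperplane of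
  \<open>P\<close>, which fixes the sign of the coefficient belonging to the other edge.\<close>

lemma two_face_cone:
  fixes P :: "'a::euclidean_space set"
  assumes "polyhedron P" and F: "F face_of P" "aff_dim F = 2"
    and e: "closed_segment v w face_of P" "closed_segment v w' face_of P"
    and ww': "w \<in> F" "w' \<in> F" "v \<in> F" "v \<noteq> w" "w' \<notin> affine hull {v, w}"
    and y: "y \<in> F"
  obtains \<beta> \<gamma> where "\<beta> \<ge> 0" "\<gamma> \<ge> 0" "y - v = \<beta> *\<^sub>R (w - v) + \<gamma> *\<^sub>R (w' - v)"
proof -
  have "F \<subseteq> P"
    using F(1) face_of_imp_subset by blast
  \<comment> \<open>Stated for one edge \<open>v p\<close> and a second point \<open>q\<close>, so
    that it serves both coefficients with the roles of \<open>w\<close> and \<open>w'\<close>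
    exchanged.\<close>
  have nonneg: "r \<ge> 0" if pq: "closed_segment v p face_of P" "q \<in> F" "q \<notin> closed_segment v p"
      "y - v = s *\<^sub>R (p - v) + r *\<^sub>R (q - v)" for p q r s
  proof -
    have "closed_segment v p \<noteq> {}" "closed_segment v p \<noteq> P"
      using \<open>q \<in> F\<close> \<open>F \<subseteq> P\<close> pq(3) by auto
    then obtain a b where ab: "P \<subseteq> {x. a \<bullet> x \<le> b}" "closed_segment v p = P \<inter> {x. a \<bullet> x = b}"
      using pq(1) exposed_face_of_polyhedron[OF \<open>polyhedron P\<close>] unfolding exposed_face_of by metis
    have vp: "a \<bullet> v = b" "a \<bullet> p = b"
      using ab(2) ends_in_segment by blast+
    have "a \<bullet> (y - v) = s * (a \<bullet> (p - v)) + r * (a \<bullet> (q - v))"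
      by (simp only: pq(4) inner_add_right inner_scaleR_right)
    then have "a \<bullet> y - b = r * (a \<bullet> q - b)"
      by (simp add: inner_diff_right vp)
    moreover have "a \<bullet> y \<le> b" "a \<bullet> q \<le> b" "a \<bullet> q \<noteq> b"
      using ab \<open>F \<subseteq> P\<close> y pq(2,3) by blast+
    ultimately have "r * (a \<bullet> q - b) \<le> 0" "a \<bullet> q - b < 0"
      by linarith+
    then show ?thesis
      by (simp add: mult_le_0_iff)
  qed
  have "aff_dim {w', v, w} = 2"
    using ww' by (simp add: aff_dim_insert aff_dim_2)
  then have "affine hull {w', v, w} = affine hull F"
    using aff_dim_eq_full_gen[of "{w', v, w}" F] F(2) ww' by auto
  then have "y \<in> affine hull {w', v, w}"
    using y by (simp add: hull_inc)
  then obtain r s q where rsq: "y = r *\<^sub>R w' + s *\<^sub>R v + q *\<^sub>R w" "r + s + q = 1"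
    unfolding affine_hull_3 by blast
  have s: "s = 1 - r - q"
    using rsq(2) by simp
  then have eq: "y - v = q *\<^sub>R (w - v) + r *\<^sub>R (w' - v)"
    unfolding rsq(1) s by (simp add: algebra_simps)
  have w'n: "w' \<notin> closed_segment v w"
    using ww'(5) convex_hull_subset_affine_hull by (auto simp: segment_convex_hull)
  have wn: "w \<notin> closed_segment v w'"
  proof
    assume "w \<in> closed_segment v w'"
    then obtain u where u: "w = (1 - u) *\<^sub>R v + u *\<^sub>R w'"
      unfolding in_segment by blast
    then have "u \<noteq> 0"
      using \<open>v \<noteq> w\<close> by auto
    then have "w' = (1 - 1/u) *\<^sub>R v + (1/u) *\<^sub>R w"
      by (simp add: u algebra_simps)
    moreover have "(1 - 1/u) *\<^sub>R v + (1/u) *\<^sub>R w \<in> affine hull {v, w}"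
      by (intro mem_affine[OF affine_affine_hull]) (auto intro: hull_inc)
    ultimately show False
      using ww'(5) by simp
  qed
  show thesis
  proof
    show "q \<ge> 0"
      using nonneg[OF e(2) ww'(1) wn, of r q] eq by (simp add: add.commute)
    show "r \<ge> 0"
      using nonneg[OF e(1) ww'(2) w'n] eq by blast
  qed (rule eq)
qed

text \<open>
  Where \<open>h\<close> exposes \<open>v\<close>, this is the value of the functional induced by \<open>c\<close> at the point of
  the vertex figure of \<open>v\<close> in direction \<open>w - v\<close>.
\<close>

definition slope :: "'a::real_inner \<Rightarrow> 'a \<Rightarrow> 'a \<Rightarrow> 'a \<Rightarrow> real" where
  "slope c h v w = - (c \<bullet> (w - v)) / (h \<bullet> (w - v))"

text \<open>The functional \<open>c'\<close> is constant on the line through \<open>v\<close> and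
  \<open>w\<close>, and its sign at \<open>y - v\<close> tells whether the slope of \<open>y\<close>
  exceeds that of \<open>w\<close>. So a face increasing \<open>c'\<close> above the edge is a
  2-face with a steeper point, and an edge of it increasing \<open>c'\<close> at \<open>v\<close> is
  a steeper edge.\<close>

lemma steeper_edge:
  fixes P :: "'a::euclidean_space set"
  assumes "polyhedron P" and v: "v extreme_point_of P"
    and tail: "\<And>u. u \<in> tail_cone P \<Longrightarrow> c \<bullet> u \<le> 0"
    and h: "\<And>x. x \<in> P \<Longrightarrow> x \<noteq> v \<Longrightarrow> h \<bullet> (x - v) < 0"
    and D: "closed_segment v w edge_of P" "c \<bullet> w > c \<bullet> v"
    and x: "x \<in> P" "x \<noteq> v" "slope c h v x > slope c h v w"
  obtains F w' where "F face_of P" "aff_dim F = 2" "closed_segment v w \<subseteq> F"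
    "closed_segment v w' \<subseteq> F" "closed_segment v w' edge_of P" "w' extreme_point_of P"
    "slope c h v w' > slope c h v w" "c \<bullet> w' > c \<bullet> v"
    "\<And>y. y \<in> F \<Longrightarrow> y \<noteq> v \<Longrightarrow> c \<bullet> y > c \<bullet> v"
proof -
  define \<sigma> where "\<sigma> = slope c h v w"
  define c' where "c' = c + \<sigma> *\<^sub>R h"
  have "w \<noteq> v"
    using D by auto
  have "v \<in> P" "w \<in> P"
    using D(1) edge_of_imp_subset by fastforce+
  have hw: "h \<bullet> (w - v) < 0"
    using h \<open>w \<in> P\<close> \<open>w \<noteq> v\<close> by blast
  then have "\<sigma> > 0"
    using D(2) by (simp add: \<sigma>_def slope_def inner_diff_right zero_less_divide_iff)
  have c': "c' \<bullet> (y - v) = (- (h \<bullet> (y - v))) * (slope c h v y - \<sigma>)" if "y \<in> P" "y \<noteq> v" for y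
    using h[OF that] by (simp add: c'_def inner_add_left slope_def field_simps)
  have "c' \<bullet> (w - v) = 0"
    using c'[OF \<open>w \<in> P\<close> \<open>w \<noteq> v\<close>] by (simp add: \<sigma>_def)
  then have c'w: "c' \<bullet> w = c' \<bullet> v"
    by (simp add: inner_diff_right)
  have c'D: "c' \<bullet> y = c' \<bullet> v" if "y \<in> affine hull {v, w}" for y
    using that unfolding affine_hull_2_alt by (auto simp: inner_add_right inner_diff_right c'w)
  have seg_hull: "closed_segment v w \<subseteq> affine hull {v, w}"
    by (simp add: convex_hull_subset_affine_hull segment_convex_hull)
  have "c' \<bullet> (x - v) > 0"
    using c'[OF x(1,2)] h[OF x(1,2)] x(3) by (simp add: \<sigma>_def mult_neg_pos)
  then have c'x: "c' \<bullet> x > c' \<bullet> v"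
    by (simp add: inner_diff_right)
  have D': "closed_segment v w face_of P" "aff_dim (closed_segment v w) = 1"
    using D(1) by (auto simp: edge_of_def)
  have c'seg: "c' \<bullet> y = c' \<bullet> v" if "y \<in> closed_segment v w" for y
    using c'D seg_hull that by blast
  obtain F where F': "F face_of P" "closed_segment v w \<subseteq> F"
      "aff_dim F = aff_dim (closed_segment v w) + 1" and "\<exists>x'\<in>F. c' \<bullet> x' > c' \<bullet> v"
    by (rule increasing_face[OF \<open>polyhedron P\<close> D'(1) _ c'seg x(1) c'x]) simp
  then obtain x' where x': "x' \<in> F" "c' \<bullet> x' > c' \<bullet> v"
    by blast
  have F: "F face_of P" "closed_segment v w \<subseteq> F" "aff_dim F = 2"
    using F' D'(2) by auto
  have "polyhedron F" "F \<subseteq> P"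
    using F(1) \<open>polyhedron P\<close> face_of_polyhedron_polyhedron face_of_imp_subset by blast+
  have "v \<in> F" "w \<in> F"
    using F(2) by auto
  have vF: "v extreme_point_of F"
    using extreme_point_of_face[OF F(1)] v \<open>v \<in> F\<close> by blast
  \<comment> \<open>Neither \<open>c\<close> nor \<open>h\<close> increases along recession
    directions, and \<open>\<sigma>\<close> is positive. This allows \<open>increasing_edge\<close>
    to be applied inside \<open>F\<close>.\<close>
  have tail': "c' \<bullet> u \<le> 0" if "u \<in> tail_cone F" for u
  proof -
    have u: "u \<in> tail_cone P"
      using tail_cone_mono[OF \<open>polyhedron P\<close> \<open>F \<subseteq> P\<close>] \<open>v \<in> F\<close> that by blast
    then have "u + v \<in> P"
      using \<open>v \<in> P\<close> by (auto simp: tail_cone_def)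
    then have "h \<bullet> u \<le> 0"
      using h[of "u + v"] by (cases "u = 0") auto
    then show ?thesis
      using tail[OF u] \<open>\<sigma> > 0\<close> by (simp add: c'_def inner_add_left mult_nonneg_nonpos add_nonpos_nonpos)
  qed
  obtain w' where w': "w' extreme_point_of F" "closed_segment v w' edge_of F" "c' \<bullet> w' > c' \<bullet> v"
    using increasing_edge[OF \<open>polyhedron F\<close> vF tail' x'] by blast
  have w'P: "w' extreme_point_of P" "closed_segment v w' edge_of P"
    using w' F(1) extreme_point_of_face[OF F(1)] by (auto simp: edge_of_def intro: face_of_trans)
  have "closed_segment v w' \<subseteq> F"
    using w'(2) edge_of_imp_subset by blast
  then have "w' \<in> F"
    by auto
  have "w' \<noteq> v"
    using w'(3) by auto
  have hw': "h \<bullet> (w' - v) < 0"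
    using h \<open>w' \<in> F\<close> \<open>F \<subseteq> P\<close> \<open>w' \<noteq> v\<close> by blast
  have "(- (h \<bullet> (w' - v))) * (slope c h v w' - \<sigma>) > 0"
    using c'[of w'] w'(3) \<open>w' \<in> F\<close> \<open>F \<subseteq> P\<close> \<open>w' \<noteq> v\<close> by (force simp: inner_diff_right)
  then have slope: "slope c h v w' > \<sigma>"
    using hw' by (simp add: mult_less_0_iff)
  then have "slope c h v w' > 0"
    using \<open>\<sigma> > 0\<close> by linarith
  then have cw': "c \<bullet> w' > c \<bullet> v"
    using hw' by (simp add: slope_def zero_less_divide_iff inner_diff_right)
  have w'n: "w' \<notin> affine hull {v, w}"
    using c'D w'(3) by fastforce
  \<comment> \<open>\<open>F\<close> lies in the angle at \<open>v\<close> spanned by the edges to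
    \<open>w\<close> and \<open>w'\<close>, and \<open>c\<close> increases along both.\<close>
  have pos: "c \<bullet> y > c \<bullet> v" if "y \<in> F" "y \<noteq> v" for y
  proof -
    obtain \<beta> \<gamma> where bc: "\<beta> \<ge> 0" "\<gamma> \<ge> 0" "y - v = \<beta> *\<^sub>R (w - v) + \<gamma> *\<^sub>R (w' - v)"
      using two_face_cone[OF \<open>polyhedron P\<close> F(1,3) D'(1) _ \<open>w \<in> F\<close> \<open>w' \<in> F\<close> \<open>v \<in> F\<close> _ w'n \<open>y \<in> F\<close>]
        w'P(2) \<open>w \<noteq> v\<close> by (auto simp: edge_of_def)
    then have "\<beta> > 0 \<or> \<gamma> > 0"
      using \<open>y \<noteq> v\<close> by (cases "\<beta> = 0"; cases "\<gamma> = 0") auto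
    then have "\<beta> * (c \<bullet> (w - v)) + \<gamma> * (c \<bullet> (w' - v)) > 0"
      using bc(1,2) D(2) cw' by (auto simp: inner_diff_right intro: add_pos_nonneg add_nonneg_pos)
    also have "\<beta> * (c \<bullet> (w - v)) + \<gamma> * (c \<bullet> (w' - v)) = c \<bullet> (y - v)"
      by (simp add: bc(3) inner_add_right)
    finally show ?thesis
      by (simp add: inner_diff_right)
  qed
  show thesis
    using that[OF F(1,3,2) \<open>closed_segment v w' \<subseteq> F\<close> w'P(2,1) _ cw' pos] slope
    by (simp add: \<sigma>_def)
qed

section \<open>Path independence\<close>

lemma compact_edge_iff:
  "{i, j} \<in> compact_edges P v \<longleftrightarrow> closed_segment (v i) (v j) edge_of P"
  unfolding compact_edges_def by (force simp: doubleton_eq_iff closed_segment_commute)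

lemma compact_edge_ends_distinct: "{i, j} \<in> compact_edges P v \<Longrightarrow> v i \<noteq> v j"
  by (auto simp: compact_edge_iff edge_of_def)

text \<open>With only two vertices both cyclic steps would be the same unordered pair, hence the
  bound 3.\<close>

lemma cycle_edge_inj:
  assumes "distinct us" "length us \<ge> 3"
  shows "inj_on (\<lambda>k. {us ! k, us ! (Suc k mod length us)}) {..<length us}"
proof (rule inj_onI)
  fix k l
  assume kl: "k \<in> {..<length us}" "l \<in> {..<length us}"
    and "{us ! k, us ! (Suc k mod length us)} = {us ! l, us ! (Suc l mod length us)}"
  moreover have "Suc k mod length us < length us" "Suc l mod length us < length us"
    using kl by (auto intro!: mod_less_divisor)
  ultimately have "k = l \<or> k = Suc l mod length us \<and> l = Suc k mod length us"
    using assms(1) kl by (auto simp: doubleton_eq_iff nth_eq_iff_index_eq)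
  then show "k = l"
    using kl assms(2) by (auto simp: mod_Suc split: if_splits)
qed

lemma sum_cyclic_differences:
  fixes g :: "'m \<Rightarrow> 'b::ab_group_add"
  shows "(\<Sum>k<length us. g (us ! (Suc k mod length us)) - g (us ! k)) = 0"
proof (cases "length us")
  case (Suc n)
  have "(\<Sum>k<n. g (us ! (Suc k mod Suc n))) = (\<Sum>k<n. g (us ! Suc k))"
    by (intro sum.cong) auto
  then show ?thesis
    unfolding Suc sum_subtractf sum.lessThan_Suc_shift[of "\<lambda>k. g (us ! k)"] by simp
qed simp

text \<open>The defects of \<open>f\<close> against the differences of \<open>g\<close> sum to zero
  around the cycle. They vanish away from \<open>i\<close> and on the edge to \<open>l\<close>, so
  the one remaining defect, on the edge to \<open>j\<close>, vanishes as well.\<close>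

lemma cycle_second_edge:
  fixes f :: "'m \<Rightarrow> 'm \<Rightarrow> 'b::ab_group_add"
  assumes us: "distinct us" and antisym: "\<And>i j. f j i = - f i j"
    and closed: "(\<Sum>k<length us. f (us ! k) (us ! (Suc k mod length us))) = 0"
    and other: "\<And>k. k < length us \<Longrightarrow> us ! k \<noteq> i \<Longrightarrow> us ! (Suc k mod length us) \<noteq> i \<Longrightarrow>
      f (us ! k) (us ! (Suc k mod length us)) = g (us ! (Suc k mod length us)) - g (us ! k)"
    and j: "\<exists>k<length us. {i, j} = {us ! k, us ! (Suc k mod length us)}"
    and l: "\<exists>k<length us. {i, l} = {us ! k, us ! (Suc k mod length us)}"
    and "j \<noteq> l" and il: "f i l = g l - g i"
  shows "f i j = g j - g i"
proof -
  let ?n = "length us"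
  define s where "s k = Suc k mod ?n" for k
  obtain k1 k2 where k1: "k1 < ?n" "{i, j} = {us ! k1, us ! s k1}"
    and k2: "k2 < ?n" "{i, l} = {us ! k2, us ! s k2}"
    using j l unfolding s_def by blast
  have s_inj: "k = k'" if "k < ?n" "k' < ?n" "s k = s k'" for k k'
    using that by (auto simp: s_def mod_Suc split: if_splits)
  have s_lt: "s k < ?n" if "k < ?n" for k
    using that mod_less_divisor[of ?n "Suc k"] unfolding s_def by linarith
  have f_eq: "f a b = g b - g a \<longleftrightarrow> f a' b' = g b' - g a'" if "{a, b} = {a', b'}" for a b a' b'
    using that antisym[of a b] by (auto simp: doubleton_eq_iff algebra_simps minus_equation_iff)
  have "k1 \<noteq> k2"
    using k1(2) k2(2) \<open>j \<noteq> l\<close> by (auto simp: doubleton_eq_iff)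
  define D where "D k = f (us ! k) (us ! s k) - (g (us ! s k) - g (us ! k))" for k
  have D0: "D k = 0" if k: "k < ?n" "k \<noteq> k1" for k
  proof (cases "us ! k \<noteq> i \<and> us ! s k \<noteq> i")
    case True
    then show ?thesis
      using other[of k] k unfolding D_def s_def by simp
  next
    case False
    \<comment> \<open>As \<open>us\<close> is distinct, one index has \<open>us ! k = i\<close> and
      one has \<open>us ! s k = i\<close>. So at most two edges of the cycle touch \<open>i\<close>,
      namely those of \<open>k1\<close> and \<open>k2\<close>.\<close>
    have "k = k2"
    proof (rule ccontr)
      assume "k \<noteq> k2"
      have "i \<in> {us ! k1, us ! s k1}" "i \<in> {us ! k2, us ! s k2}"
        unfolding k1(2)[symmetric] k2(2)[symmetric] by simp_all
      then have "us ! k1 = i \<or> us ! s k1 = i" "us ! k2 = i \<or> us ! s k2 = i"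
        by auto
      moreover have "a = b" if "us ! a = i" "us ! b = i" "a < ?n" "b < ?n" for a b
        using that us nth_eq_iff_index_eq[of us a b] by simp
      moreover from this have "a = b" if "us ! s a = i" "us ! s b = i" "a < ?n" "b < ?n" for a b
        using that s_lt s_inj by blast
      ultimately show False
        using False \<open>k \<noteq> k2\<close> k \<open>k1 \<noteq> k2\<close> k1(1) k2(1) by blast
    qed
    then show ?thesis
      using f_eq[OF k2(2)] il by (simp add: D_def)
  qed
  have "(\<Sum>k<?n. D k) = 0"
    using closed sum_cyclic_differences[of g us] by (simp add: D_def s_def sum_subtractf)
  moreover have "(\<Sum>k<?n. D k) = D k1"
    using k1(1) D0 by (subst sum.remove[of _ k1]) auto
  ultimately show ?thesis
    using f_eq[OF k1(2)] by (simp add: D_def)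
qed

text \<open>The signs turn the closing condition, a sum over unoriented edges, into a sum along a
  traversal of the boundary. At least three vertices are needed for the reindexing to be
  injective.\<close>

lemma boundary_cycle_closed:
  assumes signs: "cycle_signs P v ori eps" and F: "compact_two_face P F"
    and closing: "(\<Sum>d\<in>edges_in P v F. (eps F d * t d) *\<^sub>R edge_vec v ori d) = 0"
    and card: "card {i. v i \<in> F} \<ge> 3"
  obtains us where "boundary_cycle P v F us"
    "(\<Sum>k<length us. t {us ! k, us ! (Suc k mod length us)}
        *\<^sub>R (v (us ! (Suc k mod length us)) - v (us ! k))) = 0"
proof -
  obtain us where us: "boundary_cycle P v F us"
    and eps: "\<And>k. k < length us \<Longrightarrow> eps F {us ! k, us ! (Suc k mod length us)}
        *\<^sub>R edge_vec v ori {us ! k, us ! (Suc k mod length us)}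
        = v (us ! (Suc k mod length us)) - v (us ! k)"
    using signs F unfolding cycle_signs_def by (elim allE[of _ F]) blast
  let ?e = "\<lambda>k. {us ! k, us ! (Suc k mod length us)}"
  have "distinct us" "set us = {i. v i \<in> F}" and edges: "edges_in P v F = ?e ` {..<length us}"
    using us unfolding boundary_cycle_def by auto
  then have "length us \<ge> 3"
    using card by (metis distinct_card)
  then have "inj_on ?e {..<length us}"
    using cycle_edge_inj[OF \<open>distinct us\<close>] by blast
  then have "(\<Sum>k<length us. (eps F (?e k) * t (?e k)) *\<^sub>R edge_vec v ori (?e k)) = 0"
    using closing unfolding edges by (simp add: sum.reindex)
  moreover have "(eps F (?e k) * t (?e k)) *\<^sub>R edge_vec v ori (?e k)
      = t (?e k) *\<^sub>R (v (us ! (Suc k mod length us)) - v (us ! k))" if "k < length us" for k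
  proof -
    have "(eps F (?e k) * t (?e k)) *\<^sub>R edge_vec v ori (?e k)
        = t (?e k) *\<^sub>R (eps F (?e k) *\<^sub>R edge_vec v ori (?e k))"
      by (simp add: mult.commute)
    then show ?thesis
      by (simp only: eps[OF that])
  qed
  ultimately show thesis
    using that[OF us] by simp
qed

text \<open>Otherwise the nearer of the two points would lie in the open segment from
  \<open>v\<close> to the farther one.\<close>

lemma extreme_points_on_ray:
  fixes v w w' :: "'a::real_vector"
  assumes "v \<in> P" "w extreme_point_of P" "w' extreme_point_of P" "r > 0" "w \<noteq> v"
    and eq: "w' - v = r *\<^sub>R (w - v)"
  shows "w' = w"
proof -
  have mid: False if "p extreme_point_of P" "q extreme_point_of P" "0 < s" "s < 1" "p \<noteq> v"
    "q - v = s *\<^sub>R (p - v)" for p q s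
  proof -
    have "q = (1 - s) *\<^sub>R v + s *\<^sub>R p"
      using that(6) by (simp add: algebra_simps)
    then have "q \<in> open_segment v p"
      using that unfolding in_segment by auto
    then show False
      using that \<open>v \<in> P\<close> unfolding extreme_point_of_def by blast
  qed
  consider "r < 1" | "r = 1" | "r > 1"
    by linarith
  then show ?thesis
  proof cases
    case 1
    then show ?thesis
      using mid[of w w' r] assms by blast
  next
    case 2
    then show ?thesis
      using eq by simp
  next
    case 3
    have "w - v = (1 / r) *\<^sub>R (w' - v)"
      using eq 3 by simp
    moreover have "w' \<noteq> v"
      using eq assms by auto
    ultimately show ?thesis
      using mid[of w' w "1 / r"] assms 3 by auto
  qed
qed

text \<open>A potential makes sums of scaled edge vectors along a path telescope; this is the form
  in which path independence is used later.\<close>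

lemma edge_potential:
  fixes P :: "'a::euclidean_space set" and v :: "'m::finite \<Rightarrow> 'a"
  assumes "polyhedron P" and enum: "vertex_enum P v" and signs: "cycle_signs P v ori eps"
    and closing: "\<And>F. compact_two_face P F \<Longrightarrow>
      (\<Sum>d\<in>edges_in P v F. (eps F d * t d) *\<^sub>R edge_vec v ori d) = 0"
  obtains g where "\<And>i j. {i, j} \<in> compact_edges P v \<Longrightarrow> t {i, j} *\<^sub>R (v j - v i) = g j - g i"
proof -
  define f where "f i j = t {i, j} *\<^sub>R (v j - v i)" for i j
  have f_anti: "f j i = - f i j" for i j
    by (simp add: f_def insert_commute flip: scaleR_minus_right)
  have inj: "inj v" and range: "range v = {x. x extreme_point_of P}"
    using enum by (auto simp: vertex_enum_def bij_betw_def)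
  have ext: "v i extreme_point_of P" for i
    using range by blast
  then have vP: "v i \<in> P" for i
    by (auto simp: extreme_point_of_def)
  fix i0 :: 'm
  \<comment> \<open>Avoiding the differences of vertices makes \<open>c\<close> order the vertices
    strictly.\<close>
  define \<Delta> where "\<Delta> = (\<lambda>(i, j). v i - v j) ` {(i, j). i \<noteq> j}"
  have "finite \<Delta>" "0 \<notin> \<Delta>"
    using inj by (auto simp: \<Delta>_def dest: injD)
  then obtain c \<eta> where c: "\<eta> > 0" "\<And>x. x \<in> P \<Longrightarrow> c \<bullet> (x - v i0) \<le> - \<eta> * norm (x - v i0)"
      and "\<And>\<delta>. \<delta> \<in> \<Delta> \<Longrightarrow> c \<bullet> \<delta> \<noteq> 0"
    using generic_exposing_functional[OF \<open>polyhedron P\<close> ext[of i0]] by metis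
  then have "c \<bullet> (v i - v j) \<noteq> 0" if "i \<noteq> j" for i j
    using that by (auto simp: \<Delta>_def)
  then have c_ne: "c \<bullet> v i \<noteq> c \<bullet> v j" if "i \<noteq> j" for i j
    using that by (simp add: inner_diff_right)
  have tail: "c \<bullet> u \<le> 0" if "u \<in> tail_cone P" for u
  proof -
    have "u + v i0 \<in> P"
      using that vP by (auto simp: tail_cone_def)
    then have "c \<bullet> u \<le> - \<eta> * norm u"
      using c(2)[of "u + v i0"] by simp
    also have "\<dots> \<le> 0"
      using c(1) by simp
    finally show ?thesis .
  qed
  have bdd: "bounded X" if X: "X \<subseteq> P" "\<And>x. x \<in> X \<Longrightarrow> c \<bullet> x \<ge> \<beta>" for X \<beta>
  proof -
    have "norm (v i0 - x) \<le> (c \<bullet> v i0 - \<beta>) / \<eta>" if "x \<in> X" for x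
      using c(1) c(2)[of x] X that
      by (fastforce simp: field_simps inner_diff_right norm_minus_commute)
    then have "X \<subseteq> cball (v i0) ((c \<bullet> v i0 - \<beta>) / \<eta>)"
      by (auto simp: dist_norm)
    then show ?thesis
      using bounded_cball bounded_subset by blast
  qed
  \<comment> \<open>Induction over sets \<open>S\<close> of vertices closed upwards under
    \<open>c\<close>: a potential on the others is extended to the \<open>c\<close>-smallest vertex
    \<open>i\<close>.\<close>
  have "\<exists>g. \<forall>i\<in>S. \<forall>j\<in>S. {i, j} \<in> compact_edges P v \<longrightarrow> f i j = g j - g i"
    if "\<And>i j. i \<in> S \<Longrightarrow> c \<bullet> v j > c \<bullet> v i \<Longrightarrow> j \<in> S" for S
    using finite[of S] that
  proof (induction "card S" arbitrary: S rule: less_induct)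
    case less
    show ?case
    proof (cases "S = {}")
      case False
      define i where "i = arg_min_on (\<lambda>i. c \<bullet> v i) S"
      have "i \<in> S" and i_min: "\<And>j. j \<in> S \<Longrightarrow> c \<bullet> v i \<le> c \<bullet> v j"
        using arg_min_if_finite(1)[OF less.prems(1) False] arg_min_least[OF less.prems(1) False]
        unfolding i_def by auto
      have S': "j \<in> S - {i} \<longleftrightarrow> c \<bullet> v j > c \<bullet> v i" for j
        using i_min[of j] c_ne[of j i] less.prems(2)[OF \<open>i \<in> S\<close>, of j] by fastforce
      have "card (S - {i}) < card S"
        using less.prems(1) \<open>i \<in> S\<close> by (rule card_Diff1_less)
      moreover have "j \<in> S - {i}" if "k \<in> S - {i}" "c \<bullet> v j > c \<bullet> v k" for j k
        using that unfolding S' by linarith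
      ultimately obtain g0 where g0: "\<And>j k. j \<in> S - {i} \<Longrightarrow> k \<in> S - {i} \<Longrightarrow>
          {j, k} \<in> compact_edges P v \<Longrightarrow> f j k = g0 k - g0 j"
        using less.hyps[of "S - {i}"] less.prems(1) by (metis finite_Diff)
      \<comment> \<open>Every neighbour of \<open>i\<close> in \<open>S\<close> lies above
        \<open>i\<close>, so these are the edges on which a value at \<open>i\<close> has to be
        checked.\<close>
      define N where "N = {j. {i, j} \<in> compact_edges P v \<and> c \<bullet> v j > c \<bullet> v i}"
      have N_edge: "j \<in> N" if "{i, j} \<in> compact_edges P v" "j \<in> S" for j
        using that S'[of j] compact_edge_ends_distinct[of i j P v] by (auto simp: N_def)
      have suff: ?thesis if "\<And>j. j \<in> N \<Longrightarrow> f i j = g0 j - gi" for gi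
      proof -
        have "f j k = (g0(i := gi)) k - (g0(i := gi)) j"
          if jk: "j \<in> S" "k \<in> S" "{j, k} \<in> compact_edges P v" for j k
        proof -
          have "j \<noteq> k"
            using compact_edge_ends_distinct[OF jk(3)] by auto
          then consider "j = i" "k \<noteq> i" | "j \<noteq> i" "k = i" | "j \<noteq> i" "k \<noteq> i"
            by blast
          then show ?thesis
          proof cases
            case 1
            then show ?thesis
              using \<open>\<And>j. j \<in> N \<Longrightarrow> f i j = g0 j - gi\<close> N_edge jk by simp
          next
            case 2
            then have "f i j = g0 j - gi"
              using \<open>\<And>j. j \<in> N \<Longrightarrow> f i j = g0 j - gi\<close> N_edge jk by (simp add: insert_commute)
            then show ?thesis
              using 2 f_anti[of j i] by simp
          next
            case 3
            then show ?thesis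
              using g0 jk by simp
          qed
        qed
        then show ?thesis
          by blast
      qed
      show ?thesis
      proof (cases "N = {}")
        case True
        then show ?thesis
          using suff by blast
      next
        case False
        \<comment> \<open>\<open>h\<close> vanishes on \<open>comb (j, l)\<close> exactly when
          \<open>j\<close> and \<open>l\<close> have the same slope. These vectors are nonzero
          because no two vertices lie on one ray from \<open>v i\<close>, so a generic
          \<open>h\<close> gives all edges in \<open>N\<close> different slopes.\<close>
        define comb where "comb = (\<lambda>(j, l). (c \<bullet> (v j - v i)) *\<^sub>R (v l - v i) - (c \<bullet> (v l - v i)) *\<^sub>R (v j - v i))"
        define \<Delta>' where "\<Delta>' = comb ` {(j, l). j \<in> N \<and> l \<in> N \<and> j \<noteq> l}"
        have "finite \<Delta>'"
          by (simp add: \<Delta>'_def)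
        moreover have "comb (j, l) \<noteq> 0" if jl: "j \<in> N" "l \<in> N" "j \<noteq> l" for j l
        proof
          assume "comb (j, l) = 0"
          then have eq: "(c \<bullet> (v j - v i)) *\<^sub>R (v l - v i) = (c \<bullet> (v l - v i)) *\<^sub>R (v j - v i)"
            by (simp add: comb_def)
          define r where "r = (c \<bullet> (v l - v i)) / (c \<bullet> (v j - v i))"
          have pos: "c \<bullet> (v j - v i) > 0" "c \<bullet> (v l - v i) > 0"
            using jl by (auto simp: N_def inner_diff_right)
          then have "r > 0"
            by (simp add: r_def)
          have "v l - v i = (1 / (c \<bullet> (v j - v i))) *\<^sub>R ((c \<bullet> (v j - v i)) *\<^sub>R (v l - v i))"
            using pos by simp
          also have "\<dots> = r *\<^sub>R (v j - v i)"
            by (simp add: eq r_def)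
          finally have "v l = v j"
            using extreme_points_on_ray[OF vP ext ext \<open>r > 0\<close>, of j i l] pos by fastforce
          then show False
            using \<open>j \<noteq> l\<close> inj by (auto dest: injD)
        qed
        then have "0 \<notin> \<Delta>'"
          by (auto simp: \<Delta>'_def)
        ultimately obtain h \<theta> where h: "\<theta> > 0" "\<And>x. x \<in> P \<Longrightarrow> h \<bullet> (x - v i) \<le> - \<theta> * norm (x - v i)"
            and "\<And>\<delta>. \<delta> \<in> \<Delta>' \<Longrightarrow> h \<bullet> \<delta> \<noteq> 0"
          using generic_exposing_functional[OF \<open>polyhedron P\<close> ext[of i]] by metis
        then have h_comb: "h \<bullet> comb (j, l) \<noteq> 0" if "j \<in> N" "l \<in> N" "j \<noteq> l" for j l
          using that by (auto simp: \<Delta>'_def)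
        have h_neg: "h \<bullet> (x - v i) < 0" if "x \<in> P" "x \<noteq> v i" for x
        proof -
          have "- \<theta> * norm (x - v i) < 0"
            using h(1) that by simp
          then show ?thesis
            using h(2)[OF that(1)] by linarith
        qed
        define sl where "sl j = slope c h (v i) (v j)" for j
        have N_ne: "v j \<noteq> v i" if "j \<in> N" for j
          using that by (auto simp: N_def)
        have sl_ne: "sl j \<noteq> sl l" if "j \<in> N" "l \<in> N" "j \<noteq> l" for j l
        proof
          assume "sl j = sl l"
          then have "(c \<bullet> (v j - v i)) * (h \<bullet> (v l - v i)) = (c \<bullet> (v l - v i)) * (h \<bullet> (v j - v i))"
            using h_neg[OF vP[of j] N_ne[OF that(1)]] h_neg[OF vP[of l] N_ne[OF that(2)]]
            by (simp add: sl_def slope_def field_simps)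
          then have "h \<bullet> comb (j, l) = 0"
            by (simp only: comb_def prod.case inner_diff_right[of h "_ *\<^sub>R _"] inner_scaleR_right)
          then show False
            using h_comb that by blast
        qed
        have "Max (sl ` N) \<in> sl ` N"
          using False by (intro Max_in) auto
        then obtain j0 where "j0 \<in> N" and max: "Max (sl ` N) = sl j0"
          by blast
        moreover have "sl j \<le> sl j0" if "j \<in> N" for j
          unfolding max[symmetric] using that by (intro Max_ge) auto
        ultimately have j0: "j0 \<in> N" "\<And>j. j \<in> N \<Longrightarrow> sl j \<le> sl j0"
          by blast+
        \<comment> \<open>The steepest edge fixes the value at \<open>i\<close>. The other edges
          follow by induction on the number of steeper ones.\<close>
        define gi where "gi = g0 j0 - f i j0"
        have "f i j = g0 j - gi" if "j \<in> N" for j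
          using that
        proof (induction "card {l \<in> N. sl l > sl j}" arbitrary: j rule: less_induct)
          case (less j)
          show ?case
          proof (cases "j = j0")
            case True
            then show ?thesis
              by (simp add: gi_def)
          next
            case False
            then have "sl j0 > sl j"
              using j0 sl_ne less.prems by (metis order_le_less)
            have e: "closed_segment (v i) (v j) edge_of P" "c \<bullet> v j > c \<bullet> v i"
              using less.prems by (auto simp: N_def compact_edge_iff)
            obtain F w where F: "F face_of P" "aff_dim F = 2" "closed_segment (v i) (v j) \<subseteq> F"
                "closed_segment (v i) w \<subseteq> F" "closed_segment (v i) w edge_of P"
                "w extreme_point_of P" "slope c h (v i) w > sl j" "c \<bullet> w > c \<bullet> v i"
                "\<And>y. y \<in> F \<Longrightarrow> y \<noteq> v i \<Longrightarrow> c \<bullet> y > c \<bullet> v i"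
              using steeper_edge[OF \<open>polyhedron P\<close> ext tail h_neg e vP N_ne[OF j0(1)]]
                \<open>sl j0 > sl j\<close> unfolding sl_def by metis
            obtain l where l: "w = v l"
              using F(6) range by blast
            then have "l \<in> N" "sl l > sl j"
              using F by (auto simp: N_def compact_edge_iff sl_def)
            then have "{k \<in> N. sl k > sl l} \<subset> {k \<in> N. sl k > sl j}"
              by auto
            then have "card {k \<in> N. sl k > sl l} < card {k \<in> N. sl k > sl j}"
              by (simp add: psubset_card_mono)
            then have fl: "f i l = g0 l - gi"
              using less.hyps \<open>l \<in> N\<close> by blast
            have "j \<noteq> l"
              using \<open>sl l > sl j\<close> by auto
            \<comment> \<open>\<open>v i\<close> is the \<open>c\<close>-minimum of
              \<open>F\<close>, and parts of \<open>P\<close> where \<open>c\<close> is bounded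
              below are bounded. Hence \<open>F\<close> is compact and its closing condition is
              available.\<close>
            have "c \<bullet> y \<ge> c \<bullet> v i" if "y \<in> F" for y
              using F(9)[OF that] by (cases "y = v i") auto
            then have "bounded F"
              using bdd F(1) face_of_imp_subset by blast
            moreover have "closed F"
              using F(1) \<open>polyhedron P\<close> face_of_polyhedron_polyhedron polyhedron_imp_closed by blast
            ultimately have F2: "compact_two_face P F"
              using F(1,2) by (simp add: compact_two_face_def compact_eq_bounded_closed)
            have inF: "v i \<in> F" "v j \<in> F" "v l \<in> F"
              using F(3,4) l by auto
            have "i \<noteq> j" "i \<noteq> l"
              using N_ne less.prems \<open>l \<in> N\<close> by auto
            then have "3 = card {i, j, l}"
              using \<open>j \<noteq> l\<close> by simp
            also have "\<dots> \<le> card {k. v k \<in> F}"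
              using inF by (intro card_mono) auto
            finally obtain us where us: "boundary_cycle P v F us"
              and sum0: "(\<Sum>k<length us. f (us ! k) (us ! (Suc k mod length us))) = 0"
              using boundary_cycle_closed[OF signs F2 closing[OF F2]] unfolding f_def by blast
            have us': "distinct us" "set us = {k. v k \<in> F}"
              and us_edges: "edges_in P v F = {{us ! k, us ! (Suc k mod length us)} | k. k < length us}"
              using us by (auto simp: boundary_cycle_def)
            have on_cycle: "\<exists>k<length us. {i, q} = {us ! k, us ! (Suc k mod length us)}"
              if "q \<in> N" "closed_segment (v i) (v q) \<subseteq> F" for q
            proof -
              have "{i, q} \<in> edges_in P v F"
                using that by (simp add: edges_in_def N_def edge_seg_def segment_convex_hull)
              then show ?thesis
                unfolding us_edges by blast
            qed
            let ?g = "g0(i := gi)"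
            \<comment> \<open>Cycle edges away from \<open>i\<close> have both ends above
              \<open>i\<close>, where \<open>g0\<close> is a potential, and the steeper edge to
              \<open>l\<close> is already settled; only the edge to \<open>j\<close> is
              left.\<close>
            have "f i j = ?g j - ?g i"
            proof (rule cycle_second_edge[OF us'(1) f_anti sum0])
              fix k assume k: "k < length us" "us ! k \<noteq> i" "us ! (Suc k mod length us) \<noteq> i"
              have S'F: "us ! p \<in> S - {i}" if "p < length us" "us ! p \<noteq> i" for p
              proof -
                have "v (us ! p) \<in> F" "v (us ! p) \<noteq> v i"
                  using that us'(2) inj by (auto dest: injD)
                then show ?thesis
                  unfolding S' by (rule F(9))
              qed
              have "{us ! k, us ! (Suc k mod length us)} \<in> edges_in P v F"
                unfolding us_edges using k(1) by blast
              moreover have "Suc k mod length us < length us"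
                using k(1) mod_less_divisor[of "length us" "Suc k"] by linarith
              ultimately show "f (us ! k) (us ! (Suc k mod length us))
                  = ?g (us ! (Suc k mod length us)) - ?g (us ! k)"
                using g0 S'F k by (simp add: edges_in_def)
            next
              show "\<exists>k<length us. {i, j} = {us ! k, us ! (Suc k mod length us)}"
                using on_cycle less.prems F(3) by blast
              show "\<exists>k<length us. {i, l} = {us ! k, us ! (Suc k mod length us)}"
                using on_cycle \<open>l \<in> N\<close> F(4) l by blast
              show "j \<noteq> l" by fact
              show "f i l = ?g l - ?g i"
                using fl \<open>i \<noteq> l\<close> by simp
            qed
            then show ?thesis
              using \<open>i \<noteq> j\<close> by simp
          qed
        qed
        then show ?thesis
          using suff by blast
      qed
    qed simp
  qed
  from this[of UNIV] show thesis
    using that unfolding f_def by blast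
qed

section \<open>Dilating the edges of a polyhedron\<close>

lemma tail_cone_inequalities:
  fixes P :: "'a::euclidean_space set"
  assumes H: "finite H" "P = {x. \<forall>(a, b)\<in>H. a \<bullet> x \<le> b}" and "P \<noteq> {}"
  shows "tail_cone P = {u. \<forall>(a, b)\<in>H. a \<bullet> u \<le> 0}"
proof -
  obtain x where x: "x \<in> P"
    using \<open>P \<noteq> {}\<close> by blast
  have "a \<bullet> u \<le> 0" if "u \<in> tail_cone P" "(a, b) \<in> H" for a b u
  proof (rule ray_inequality[OF H(2) _ that(2)])
    show "\<exists>s>M. x + s *\<^sub>R u \<in> P" for M
      using tail_cone_multiple[OF that(1) x] reals_Archimedean2[of M] by blast
  qed
  moreover have "u \<in> tail_cone P" if u: "\<And>a b. (a, b) \<in> H \<Longrightarrow> a \<bullet> u \<le> 0" for u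
    unfolding tail_cone_def H(2) using u by (force simp: inner_add_right)
  ultimately show ?thesis
    by blast
qed

text \<open>As in the simplex method: a point of \<open>P\<close> better than the best vertex would
  give an increasing edge from it to a still better vertex.\<close>

lemma functional_attains_max_at_vertex:
  fixes P :: "'a::euclidean_space set" and v :: "'m::finite \<Rightarrow> 'a"
  assumes "polyhedron P" "vertex_enum P v" and tail: "\<And>u. u \<in> tail_cone P \<Longrightarrow> c \<bullet> u \<le> 0"
  obtains k where "\<And>x. x \<in> P \<Longrightarrow> c \<bullet> x \<le> c \<bullet> v k"
proof -
  have range: "range v = {x. x extreme_point_of P}"
    using assms(2) by (auto simp: vertex_enum_def bij_betw_def)
  have "Max (range (\<lambda>i. c \<bullet> v i)) \<in> range (\<lambda>i. c \<bullet> v i)"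
    by (intro Max_in) auto
  then obtain k where max: "Max (range (\<lambda>i. c \<bullet> v i)) = c \<bullet> v k"
    by blast
  have k: "c \<bullet> v i \<le> c \<bullet> v k" for i
    unfolding max[symmetric] by (intro Max_ge) auto
  have "c \<bullet> x \<le> c \<bullet> v k" if "x \<in> P" for x
  proof (rule ccontr)
    assume "\<not> ?thesis"
    moreover have "v k extreme_point_of P"
      using range by blast
    ultimately obtain w where "w extreme_point_of P" "c \<bullet> w > c \<bullet> v k"
      using increasing_edge[OF \<open>polyhedron P\<close> _ tail \<open>x \<in> P\<close>] by (metis not_le)
    then show False
      using range k by (metis mem_Collect_eq not_le rangeE)
  qed
  then show thesis
    by (rule that)
qed

text \<open>From every vertex other than \<open>v k\<close> a \<open>c\<close>-increasing edge
  starts. Its image under \<Psi> is the edge vector scaled by a nonnegative factor, so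
  \<open>c\<close> does not decrease on the images while the path climbs to
  \<open>k\<close>.\<close>

lemma dilated_support_unique_max:
  fixes P :: "'a::euclidean_space set" and v \<Psi> :: "'m::finite \<Rightarrow> 'a"
  assumes "polyhedron P" "vertex_enum P v"
    and t: "\<And>d. t d \<ge> 0" "\<And>i j. {i, j} \<in> compact_edges P v \<Longrightarrow> \<Psi> j - \<Psi> i = t {i, j} *\<^sub>R (v j - v i)"
    and max: "\<And>x. x \<in> P \<Longrightarrow> x \<noteq> v k \<Longrightarrow> c \<bullet> x < c \<bullet> v k"
  shows "c \<bullet> \<Psi> i \<le> c \<bullet> \<Psi> k"
proof -
  have inj: "inj v" and range: "range v = {x. x extreme_point_of P}"
    using assms(2) by (auto simp: vertex_enum_def bij_betw_def)
  have ext: "v i extreme_point_of P" for i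
    using range by blast
  then have vP: "v i \<in> P" for i
    by (auto simp: extreme_point_of_def)
  have tail: "c \<bullet> u \<le> 0" if "u \<in> tail_cone P" for u
  proof -
    have "u + v k \<in> P"
      using that vP by (auto simp: tail_cone_def)
    then show ?thesis
      using max[of "u + v k"] by (cases "u = 0") (auto simp: inner_add_right)
  qed
  show ?thesis
  proof (induction "card {j. c \<bullet> v j > c \<bullet> v i}" arbitrary: i rule: less_induct)
    case (less i)
    show ?case
    proof (cases "i = k")
      case False
      then have "c \<bullet> v k > c \<bullet> v i"
        using max[OF vP] inj by (auto dest: injD)
      then obtain w where w: "w extreme_point_of P" "closed_segment (v i) w edge_of P" "c \<bullet> w > c \<bullet> v i"
        using increasing_edge[OF \<open>polyhedron P\<close> ext tail vP] by blast
      then obtain j where j: "w = v j"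
        using range by blast
      have "{l. c \<bullet> v l > c \<bullet> v j} \<subset> {l. c \<bullet> v l > c \<bullet> v i}"
        using w(3) j by auto
      then have "card {l. c \<bullet> v l > c \<bullet> v j} < card {l. c \<bullet> v l > c \<bullet> v i}"
        by (simp add: psubset_card_mono)
      then have "c \<bullet> \<Psi> j \<le> c \<bullet> \<Psi> k"
        using less by blast
      moreover have "{i, j} \<in> compact_edges P v"
        using w(2) j by (simp add: compact_edge_iff)
      then have "c \<bullet> (\<Psi> j - \<Psi> i) = t {i, j} * (c \<bullet> (v j - v i))"
        using t(2) by simp
      then have "c \<bullet> (\<Psi> j - \<Psi> i) \<ge> 0"
        using t(1)[of "{i, j}"] w(3) j by (simp add: inner_diff_right)
      ultimately show ?thesis
        by (simp add: inner_diff_right)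
    qed simp
  qed
qed

text \<open>Adding a small multiple of a functional exposing \<open>v k\<close> makes the maximum
  unique; the inequality survives in the limit as the multiple tends to 0.\<close>

lemma dilated_support:
  fixes P :: "'a::euclidean_space set" and v \<Psi> :: "'m::finite \<Rightarrow> 'a"
  assumes "polyhedron P" "vertex_enum P v"
    and t: "\<And>d. t d \<ge> 0" "\<And>i j. {i, j} \<in> compact_edges P v \<Longrightarrow> \<Psi> j - \<Psi> i = t {i, j} *\<^sub>R (v j - v i)"
    and max: "\<And>x. x \<in> P \<Longrightarrow> c \<bullet> x \<le> c \<bullet> v k"
  shows "c \<bullet> \<Psi> i \<le> c \<bullet> \<Psi> k"
proof -
  have "v k extreme_point_of P"
    using assms(2) by (auto simp: vertex_enum_def bij_betw_def)
  then obtain h \<eta> where h: "\<eta> > 0" "\<And>x. x \<in> P \<Longrightarrow> h \<bullet> (x - v k) \<le> - \<eta> * norm (x - v k)"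
    using generic_exposing_functional[OF \<open>polyhedron P\<close>, of "v k" "{}"]
    by (metis empty_iff finite.emptyI)
  have le: "c \<bullet> \<Psi> i \<le> c \<bullet> \<Psi> k + e * (h \<bullet> (\<Psi> k - \<Psi> i))" if "e > 0" for e
  proof -
    have "(c + e *\<^sub>R h) \<bullet> x < (c + e *\<^sub>R h) \<bullet> v k" if "x \<in> P" "x \<noteq> v k" for x
    proof -
      have "- \<eta> * norm (x - v k) < 0"
        using h(1) that by simp
      then have "h \<bullet> (x - v k) < 0"
        using h(2)[OF that(1)] by linarith
      then have "e * (h \<bullet> (x - v k)) < 0"
        using \<open>e > 0\<close> by (simp add: mult_pos_neg)
      then show ?thesis
        using max[OF that(1)] by (simp add: inner_add_left inner_diff_right right_diff_distrib)
    qed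
    then have "(c + e *\<^sub>R h) \<bullet> \<Psi> i \<le> (c + e *\<^sub>R h) \<bullet> \<Psi> k"
      using dilated_support_unique_max[OF assms(1,2) t] by blast
    then show ?thesis
      by (simp add: inner_add_left inner_diff_right right_diff_distrib)
  qed
  show ?thesis
  proof (rule tendsto_lowerbound)
    show "((\<lambda>e. c \<bullet> \<Psi> k + e * (h \<bullet> (\<Psi> k - \<Psi> i))) \<longlongrightarrow> c \<bullet> \<Psi> k) (at_right 0)"
      by (auto intro!: tendsto_eq_intros)
    show "\<forall>\<^sub>F e in at_right 0. c \<bullet> \<Psi> i \<le> c \<bullet> \<Psi> k + e * (h \<bullet> (\<Psi> k - \<Psi> i))"
      using le by (auto simp: eventually_at_right_less intro: eventually_mono[OF eventually_at_right_less])
  qed simp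
qed

text \<open>A form of Farkas' lemma: if \<open>c\<close> were outside the closed cone, the negative
  of a separating vector \<open>d\<close> would be a feasible direction at \<open>p\<close> along
  which \<open>c\<close> increases.\<close>

lemma maximal_functional_in_active_cone:
  fixes P :: "'a::euclidean_space set"
  assumes H: "finite H" "P = {x. \<forall>(a, b)\<in>H. a \<bullet> x \<le> b}" and "p \<in> P"
    and max: "\<And>x. x \<in> P \<Longrightarrow> c \<bullet> x \<le> c \<bullet> p"
  shows "c \<in> convex_cone hull {a. \<exists>b. (a, b) \<in> H \<and> a \<bullet> p = b}" (is "c \<in> ?C")
proof (rule ccontr)
  assume "c \<notin> ?C"
  have "{a. \<exists>b. (a, b) \<in> H \<and> a \<bullet> p = b} \<subseteq> fst ` H"
    by force
  then have "closed ?C"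
    using H(1) by (meson finite_imageI finite_subset polyhedron_convex_cone_hull polyhedron_imp_closed)
  then obtain d b where d: "d \<bullet> c < b" "\<And>x. x \<in> ?C \<Longrightarrow> d \<bullet> x > b"
    using separating_hyperplane_closed_point[OF convex_convex_cone_hull _ \<open>c \<notin> ?C\<close>] by blast
  have "b < 0"
    using d(2)[OF convex_cone_hull_contains_0] by simp
  \<comment> \<open>If \<open>d\<close> were negative at \<open>a\<close>, a nonnegative multiple of
    \<open>a\<close> would reach the value \<open>b\<close>, which \<open>d\<close> strictly exceeds
    on the cone.\<close>
  have nonneg: "d \<bullet> a \<ge> 0" if "a \<in> ?C" for a
  proof (rule ccontr)
    assume neg: "\<not> ?thesis"
    then have "b / (d \<bullet> a) \<ge> 0"
      using \<open>b < 0\<close> by (simp add: zero_le_divide_iff)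
    then have "(b / (d \<bullet> a)) *\<^sub>R a \<in> ?C"
      using that convex_cone_hull_mul by blast
    from d(2)[OF this] show False
      using neg by simp
  qed
  have active: "a \<bullet> - d \<le> 0" if "(a, b) \<in> H" "a \<bullet> p = b" for a b
  proof -
    have "a \<in> ?C"
      using that by (intro hull_inc) auto
    then show ?thesis
      using nonneg by (simp add: inner_commute)
  qed
  obtain e where e: "e > 0" "\<And>s. 0 \<le> s \<Longrightarrow> s \<le> e \<Longrightarrow> p + s *\<^sub>R (- d) \<in> P"
    by (rule feasible_direction[OF H \<open>p \<in> P\<close>, of "- d"]) (use active in blast)+
  have "c \<bullet> (p + e *\<^sub>R (- d)) \<le> c \<bullet> p"
    using e by (intro max) auto
  then have "c \<bullet> d \<ge> 0"
    using e(1) by (simp add: inner_diff_right inner_add_right zero_le_mult_iff)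
  then show False
    using d(1) \<open>b < 0\<close> by (simp add: inner_commute)
qed

text \<open>The right-hand sides are written as \<open>a \<bullet> \<Psi> k\<close> so that they are
  linear in \<Psi>. For the harder inclusion, a functional separating \<open>w\<close> from the
  left-hand set is optimal over \<open>P\<close> at some vertex; there it is a nonnegative
  combination of active constraints, whose inequalities already forbid the separation.\<close>

lemma dilated_polyhedron_inequalities:
  fixes P :: "'a::euclidean_space set" and v \<Psi> :: "'m::finite \<Rightarrow> 'a"
  assumes "polyhedron P" "vertex_enum P v"
    and H: "finite H" "P = {x. \<forall>(a, b)\<in>H. a \<bullet> x \<le> b}"
    and t: "\<And>d. t d \<ge> 0" "\<And>i j. {i, j} \<in> compact_edges P v \<Longrightarrow> \<Psi> j - \<Psi> i = t {i, j} *\<^sub>R (v j - v i)"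
  shows "{x + a | x a. x \<in> convex hull range \<Psi> \<and> a \<in> tail_cone P} =
    {w. \<forall>(a, b)\<in>H. \<forall>k. a \<bullet> v k = b \<longrightarrow> a \<bullet> w \<le> a \<bullet> \<Psi> k}" (is "?S = ?W")
proof
  have vP: "v i \<in> P" for i
    using assms(2) by (auto simp: vertex_enum_def bij_betw_def extreme_point_of_def)
  then have tail_eq: "tail_cone P = {u. \<forall>(a, b)\<in>H. a \<bullet> u \<le> 0}"
    using tail_cone_inequalities[OF H] by blast
  show "?S \<subseteq> ?W"
  proof clarify
    fix x u a b k
    assume x: "x \<in> convex hull range \<Psi>" and u: "u \<in> tail_cone P" and ab: "(a, a \<bullet> v k) \<in> H"
    have "a \<bullet> y \<le> a \<bullet> v k" if "y \<in> P" for y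
      using that ab unfolding H(2) by blast
    then have "a \<bullet> \<Psi> i \<le> a \<bullet> \<Psi> k" for i
      using dilated_support[OF assms(1,2) t] by blast
    then have "convex hull range \<Psi> \<subseteq> {y. a \<bullet> y \<le> a \<bullet> \<Psi> k}"
      by (intro hull_minimal) (auto simp: convex_halfspace_le)
    moreover have "a \<bullet> u \<le> 0"
      using u ab unfolding tail_eq by blast
    ultimately show "a \<bullet> (x + u) \<le> a \<bullet> \<Psi> k"
      using x by (force simp: inner_add_right)
  qed
  have tail_halfspaces: "tail_cone P = (\<Inter>h\<in>H. {u. fst h \<bullet> u \<le> 0})"
    unfolding tail_eq by fastforce
  have "closed (tail_cone P)" "convex (tail_cone P)"
    unfolding tail_halfspaces by (auto intro!: closed_INT convex_INT closed_halfspace_le convex_halfspace_le)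
  have tail_scale: "s *\<^sub>R u \<in> tail_cone P" if "u \<in> tail_cone P" "s \<ge> 0" for u s
    using that unfolding tail_halfspaces by (auto simp: mult_nonneg_nonpos)
  have S_eq: "?S = (\<Union>x\<in>convex hull range \<Psi>. \<Union>a\<in>tail_cone P. {x + a})"
    by auto
  have "compact (convex hull range \<Psi>)"
    by (intro compact_convex_hull finite_imp_compact) simp
  then have "closed ?S"
    unfolding S_eq using \<open>closed (tail_cone P)\<close> by (rule compact_closed_sums)
  have "convex ?S"
    unfolding S_eq using \<open>convex (tail_cone P)\<close> by (intro convex_sums convex_convex_hull)
  show "?W \<subseteq> ?S"
  proof (rule subsetI, rule ccontr)
    fix w assume w: "w \<in> ?W" "w \<notin> ?S"
    obtain a b where ab: "a \<bullet> w < b" "\<And>x. x \<in> ?S \<Longrightarrow> a \<bullet> x > b"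
      using separating_hyperplane_closed_point[OF \<open>convex ?S\<close> \<open>closed ?S\<close> w(2)] by blast
    have mem: "\<Psi> i + u \<in> ?S" if "u \<in> tail_cone P" for i u
      using that hull_inc[of "\<Psi> i" "range \<Psi>"] by blast
    fix i0 :: 'm
    have "(- a) \<bullet> u \<le> 0" if "u \<in> tail_cone P" for u
    proof (rule ccontr)
      assume "\<not> ?thesis"
      then have neg: "a \<bullet> u < 0"
        by simp
      \<comment> \<open>Far enough along \<open>u\<close> for \<open>a\<close> to fall to
        \<open>b\<close> or below; the maximum with 0 keeps the multiple in the tail cone.\<close>
      define s where "s = max 0 ((b - a \<bullet> \<Psi> i0) / (a \<bullet> u))"
      have "a \<bullet> (\<Psi> i0 + s *\<^sub>R u) > b"
        using tail_scale[OF that, of s] by (intro ab(2) mem) (simp add: s_def)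
      moreover have "s * (a \<bullet> u) \<le> b - a \<bullet> \<Psi> i0"
        using neg by (auto simp: s_def max_def field_simps)
      ultimately show False
        by (simp add: inner_add_right)
    qed
    then obtain k where "\<And>x. x \<in> P \<Longrightarrow> (- a) \<bullet> x \<le> (- a) \<bullet> v k"
      using functional_attains_max_at_vertex[OF assms(1,2)] by blast
    then have "- a \<in> convex_cone hull {a. \<exists>b. (a, b) \<in> H \<and> a \<bullet> v k = b}"
      by (rule maximal_functional_in_active_cone[OF H vP])
    moreover have "a \<bullet> w \<le> a \<bullet> \<Psi> k" if "(a, b) \<in> H" "a \<bullet> v k = b" for a b
      using w(1) that by blast
    \<comment> \<open>The inequalities at \<open>v k\<close> say that \<open>w - \<Psi> k\<close> is
      nonpositive on the active normals, hence on the cone they generate, which contains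
      \<open>- a\<close>.\<close>
    then have "convex_cone hull {a. \<exists>b. (a, b) \<in> H \<and> a \<bullet> v k = b} \<subseteq> {y. (w - \<Psi> k) \<bullet> y \<le> 0}"
      by (intro hull_minimal convex_cone_halfspace_le)
        (auto simp: inner_diff_left inner_diff_right inner_commute)
    ultimately have "(w - \<Psi> k) \<bullet> (- a) \<le> 0"
      by blast
    then have "a \<bullet> \<Psi> k \<le> a \<bullet> w"
      by (simp add: inner_diff_left inner_diff_right inner_commute)
    moreover have "a \<bullet> \<Psi> k > b"
      using ab(2)[OF mem[of 0 k]] by (simp add: tail_eq)
    ultimately show False
      using ab(1) by simp
  qed
qed

section \<open>Linear inequalities for the tautological cone\<close>

lemma psi_edge_path:
  assumes "edge_path P v i j us"
    and "\<And>i j. {i, j} \<in> compact_edges P v \<Longrightarrow> (fst xi $ {i, j}) *\<^sub>R (v j - v i) = g j - g i"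
  shows "psi v xi us = (snd xi $ i) *\<^sub>R v i + (g j - g i)"
proof -
  have us: "us \<noteq> []" "hd us = i" "last us = j"
    "\<And>k. Suc k < length us \<Longrightarrow> {us ! k, us ! Suc k} \<in> compact_edges P v"
    using assms(1) by (auto simp: edge_path_def)
  have "(\<Sum>k<length us - 1. (fst xi $ {us ! k, us ! Suc k}) *\<^sub>R (v (us ! Suc k) - v (us ! k)))
      = (\<Sum>k<length us - 1. g (us ! Suc k) - g (us ! k))"
    using us(4) by (intro sum.cong) (auto intro!: assms(2))
  also have "\<dots> = g (us ! (length us - 1)) - g (us ! 0)"
    by (rule sum_lessThan_telescope)
  also have "\<dots> = g j - g i"
    using us by (simp add: last_conv_nth hd_conv_nth)
  finally show ?thesis
    by (simp add: psi_def us(2))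
qed

lemma linear_psi: "linear (\<lambda>xi. psi v xi us)"
  by (intro linearI)
    (simp_all add: psi_def scaleR_add_left scaleR_add_right sum.distrib scaleR_sum_right)

lemma subspace_T_space: "subspace (T_space N P v ori eps)"
proof (rule subspaceI)
  show "0 \<in> T_space N P v ori eps"
    by (simp add: T_space_def zero_prod_def)
next
  fix x y assume xy: "x \<in> T_space N P v ori eps" "y \<in> T_space N P v ori eps"
  have "(\<Sum>d\<in>edges_in P v F. (eps F d * (fst x $ d + fst y $ d)) *\<^sub>R edge_vec v ori d) =
      (\<Sum>d\<in>edges_in P v F. (eps F d * fst x $ d) *\<^sub>R edge_vec v ori d) +
      (\<Sum>d\<in>edges_in P v F. (eps F d * fst y $ d) *\<^sub>R edge_vec v ori d)" for F
    by (simp add: distrib_left scaleR_add_left sum.distrib)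
  with xy show "x + y \<in> T_space N P v ori eps"
    by (cases x; cases y) (auto simp: T_space_def)
next
  fix r x assume x: "x \<in> T_space N P v ori eps"
  have "(\<Sum>d\<in>edges_in P v F. (eps F d * (r * fst x $ d)) *\<^sub>R edge_vec v ori d) =
      r *\<^sub>R (\<Sum>d\<in>edges_in P v F. (eps F d * fst x $ d) *\<^sub>R edge_vec v ori d)" for F
    by (simp add: scaleR_sum_right mult.left_commute)
  with x show "r *\<^sub>R x \<in> T_space N P v ori eps"
    by (cases x) (auto simp: T_space_def)
qed

lemma polyhedral_cone_linear_le:
  fixes L :: "'a::euclidean_space \<Rightarrow> real"
  assumes "linear L"
  shows "polyhedron {z. L z \<le> 0}" "convex_cone {z. L z \<le> 0}"
proof -
  have "{z. L z \<le> 0} = {z. adjoint L 1 \<bullet> z \<le> 0}"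
    using adjoint_works[OF assms, of _ 1] by (simp add: inner_commute)
  then show "polyhedron {z. L z \<le> 0}" "convex_cone {z. L z \<le> 0}"
    by (simp_all add: polyhedron_halfspace_le convex_cone_halfspace_le)
qed

lemma polyhedral_cone_subspace:
  fixes S :: "'a::euclidean_space set"
  assumes "subspace S"
  shows "polyhedron S" "convex_cone S"
  by (simp_all add: assms affine_imp_polyhedron subspace_imp_affine convex_cone_iff
      subspace_0 subspace_add subspace_scale)

text \<open>The paths \<open>pth xi\<close> may vary with \<open>xi\<close>. By path independence
  they can be replaced by one family \<open>q\<close>, after which \<open>psi\<close> is linear in
  \<open>xi\<close>.\<close>

lemma tautological_cone_inequalities:
  fixes N P :: "'a::euclidean_space set" and v :: "'m::finite \<Rightarrow> 'a"
  assumes "polyhedron P" "vertex_enum P v" "cycle_signs P v ori eps"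
    and H: "finite H" "P = {x. \<forall>(a, b)\<in>H. a \<bullet> x \<le> b}"
    and pth: "\<And>xi i. xi \<in> T_plus N P v ori eps \<Longrightarrow> edge_path P v istar i (pth xi i)"
    and q: "\<And>i. edge_path P v istar i (q i)"
  shows "tautological_cone N P v ori eps pth = {(xi, w). xi \<in> T_plus N P v ori eps
    \<and> (\<forall>(a, b)\<in>H. \<forall>k. a \<bullet> v k = b \<longrightarrow> a \<bullet> w \<le> a \<bullet> psi v xi (q k))}"
proof -
  have "P_fibre P v pth xi = {w. \<forall>(a, b)\<in>H. \<forall>k. a \<bullet> v k = b \<longrightarrow> a \<bullet> w \<le> a \<bullet> psi v xi (q k)}"
    if xi: "xi \<in> T_plus N P v ori eps" for xi
  proof -
    have closing: "(\<Sum>d\<in>edges_in P v F. (eps F d * fst xi $ d) *\<^sub>R edge_vec v ori d) = 0"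
      if "compact_two_face P F" for F
      using xi that by (auto simp: T_plus_def T_space_def)
    obtain g where g: "\<And>i j. {i, j} \<in> compact_edges P v \<Longrightarrow>
        (fst xi $ {i, j}) *\<^sub>R (v j - v i) = g j - g i"
      by (rule edge_potential[OF assms(1-3), of "\<lambda>d. fst xi $ d"]) (use closing in blast)+
    have psi_eq: "psi v xi (pth xi i) = psi v xi (q i)" for i
      using psi_edge_path[OF pth[OF xi] g] psi_edge_path[OF q g] by simp
    have "{x + a | x a. x \<in> convex hull range (\<lambda>i. psi v xi (q i)) \<and> a \<in> tail_cone P}
        = {w. \<forall>(a, b)\<in>H. \<forall>k. a \<bullet> v k = b \<longrightarrow> a \<bullet> w \<le> a \<bullet> psi v xi (q k)}"
    proof (rule dilated_polyhedron_inequalities[OF assms(1,2) H])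
      show "fst xi $ d \<ge> 0" for d
        using xi by (auto simp: T_plus_def)
      show "psi v xi (q j) - psi v xi (q i) = (fst xi $ {i, j}) *\<^sub>R (v j - v i)"
        if "{i, j} \<in> compact_edges P v" for i j
        using psi_edge_path[OF q g] g[OF that] by simp
    qed
    then show ?thesis
      by (simp add: P_fibre_def psi_eq)
  qed
  then show ?thesis
    unfolding tautological_cone_def by blast
qed

lemma polyhedral_tautological_cone:
  fixes N P :: "'a::euclidean_space set" and v :: "'m::finite \<Rightarrow> 'a" and ori eps q
  assumes "finite H"
  defines "C \<equiv> {(xi, w). xi \<in> T_plus N P v ori eps
    \<and> (\<forall>(a, b)\<in>H. \<forall>k. a \<bullet> v k = b \<longrightarrow> a \<bullet> w \<le> a \<bullet> psi v xi (q k))}"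
  shows "polyhedron C" "convex_cone C"
proof -
  \<comment> \<open>The cone is the intersection of a subspace with three finite families of
    half-spaces through 0: nonnegativity of \<open>t\<close>, nonnegativity of \<open>s\<close>, and
    the inequalities of the fibres.\<close>
  define A :: "(((real ^ 'm set) \<times> (real ^ 'm)) \<times> 'a) set" where "A = fst -` T_space N P v ori eps"
  define B where "B = range (\<lambda>d. {z :: ((real ^ 'm set) \<times> (real ^ 'm)) \<times> 'a. - (fst (fst z) $ d) \<le> 0})"
  define D where "D = range (\<lambda>i. {z :: ((real ^ 'm set) \<times> (real ^ 'm)) \<times> 'a. - (snd (fst z) $ i) \<le> 0})"
  define E where "E = (\<lambda>p. {z. fst (fst p) \<bullet> snd z - fst (fst p) \<bullet> psi v (fst z) (q (snd p)) \<le> 0})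
    ` {p \<in> H \<times> UNIV. fst (fst p) \<bullet> v (snd p) = snd (fst p)}"
  have "subspace A"
    unfolding A_def using linear_fst subspace_T_space by (rule linear_subspace_vimage)
  note A = polyhedral_cone_subspace[OF this]
  have "linear (\<lambda>z. - (fst (fst z) $ d))" "linear (\<lambda>z. - (snd (fst z) $ i))"
    for d i by (auto intro!: linearI)
  then have BD: "polyhedron X" "convex_cone X" if "X \<in> B \<union> D" for X
    using that polyhedral_cone_linear_le unfolding B_def D_def by blast+
  have "linear (\<lambda>z. a \<bullet> snd z - a \<bullet> psi v (fst z) (q k))" for a k
    by (intro linearI) (simp_all add: linear_add[OF linear_psi] linear_cmul[OF linear_psi]
        inner_add_right right_diff_distrib)
  note lin = polyhedral_cone_linear_le[OF this]
  have E: "polyhedron X" "convex_cone X" if "X \<in> E" for X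
    using that lin unfolding E_def by blast+
  have "z \<in> \<Inter> (insert A (B \<union> D \<union> E)) \<longleftrightarrow> z \<in> C" for z
  proof -
    have "z \<in> A \<longleftrightarrow> fst z \<in> T_space N P v ori eps"
      by (simp add: A_def)
    moreover have "(\<forall>X\<in>B. z \<in> X) \<longleftrightarrow> (\<forall>d. fst (fst z) $ d \<ge> 0)"
      "(\<forall>X\<in>D. z \<in> X) \<longleftrightarrow> (\<forall>i. snd (fst z) $ i \<ge> 0)"
      by (simp_all add: B_def D_def)
    moreover have "(\<forall>X\<in>E. z \<in> X) \<longleftrightarrow>
        (\<forall>(a, b)\<in>H. \<forall>k. a \<bullet> v k = b \<longrightarrow> a \<bullet> snd z \<le> a \<bullet> psi v (fst z) (q k))"
      by (auto simp: E_def)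
    ultimately show ?thesis
      by (cases z; cases "fst z") (auto simp: C_def T_plus_def)
  qed
  then have C: "C = \<Inter> (insert A (B \<union> D \<union> E))"
    by blast
  have "finite (insert A (B \<union> D \<union> E))"
    using \<open>finite H\<close> by (simp add: B_def D_def E_def)
  then show "polyhedron C"
    unfolding C using A(1) BD(1) E(1) by (intro polyhedron_Inter) auto
  show "convex_cone C"
    unfolding C using A(2) BD(2) E(2) by (intro convex_cone_Inter) auto
qed

theorem theorem9p5:
  fixes N P :: "'a::euclidean_space set"
    and v :: "'m::finite \<Rightarrow> 'a"
    and ori :: "'m set \<Rightarrow> 'm \<times> 'm"
    and eps :: "'a set \<Rightarrow> 'm set \<Rightarrow> real"
    and istar :: 'm
    and pth :: "(real ^ 'm set) \<times> (real ^ 'm) \<Rightarrow> 'm \<Rightarrow> 'm list"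
  assumes "free_lattice N"
    and "rational_polyhedron N P"
    and "vertex_enum P v"
    and "edge_orientation P v ori"
    and "cycle_signs P v ori eps"
    and "\<And>xi i. xi \<in> T_plus N P v ori eps \<Longrightarrow> edge_path P v istar i (pth xi i)"
  shows "tautological_cone N P v ori eps pth \<subseteq> T_plus N P v ori eps \<times> span N
    \<and> convex_cone (tautological_cone N P v ori eps pth)
    \<and> polyhedron (tautological_cone N P v ori eps pth)"
proof -
  obtain G where G: "finite G" "P = {x \<in> span N. \<forall>(a, b)\<in>G. a \<bullet> x \<le> b}"
    using assms(2) by (auto simp: rational_polyhedron_def)
  have "P = span N \<inter> \<Inter> ((\<lambda>(a, b). {x. a \<bullet> x \<le> b}) ` G)"
    unfolding G(2) by auto
  moreover have "polyhedron (\<Inter> ((\<lambda>(a, b). {x. a \<bullet> x \<le> b}) ` G))"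
    using G(1) by (intro polyhedron_Inter) (auto simp: polyhedron_halfspace_le)
  ultimately have "polyhedron P"
    by (simp add: polyhedral_cone_subspace(1) polyhedron_Int)
  \<comment> \<open>Unlike \<open>G\<close>, the system \<open>H\<close> describes \<open>P\<close>
    in the whole ambient space, including the restriction to \<open>span N\<close>.\<close>
  then obtain H where H: "finite H" "P = {x. \<forall>(a, b)\<in>H. a \<bullet> x \<le> b}"
    using polyhedron_inequalities by blast
  have vP: "v i \<in> P" for i
    using assms(3) by (auto simp: vertex_enum_def bij_betw_def extreme_point_of_def)
  have "P \<subseteq> span N"
    using G(2) by blast
  have psi_span: "psi v xi us \<in> span N" for xi us
    unfolding psi_def using vP \<open>P \<subseteq> span N\<close>
    by (intro span_add span_sum span_scale span_diff) auto
  have tail_span: "tail_cone P \<subseteq> span N"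
  proof
    fix u assume "u \<in> tail_cone P"
    then have "u + v istar \<in> span N"
      using vP \<open>P \<subseteq> span N\<close> by (auto simp: tail_cone_def)
    then show "u \<in> span N"
      using vP \<open>P \<subseteq> span N\<close> by (metis add_diff_cancel_right' span_diff subsetD)
  qed
  have "P_fibre P v pth xi \<subseteq> span N" for xi
  proof -
    have "convex hull range (\<lambda>i. psi v xi (pth xi i)) \<subseteq> span N"
      by (intro hull_minimal image_subsetI psi_span) (simp add: subspace_imp_convex)
    then show ?thesis
      unfolding P_fibre_def using tail_span by (blast intro: span_add)
  qed
  then have sub: "tautological_cone N P v ori eps pth \<subseteq> T_plus N P v ori eps \<times> span N"
    unfolding tautological_cone_def by blast
  \<comment> \<open>The paths chosen for the zero element serve as the common family for all
    \<open>xi\<close>.\<close>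
  have "0 \<in> T_plus N P v ori eps"
    using subspace_0[OF subspace_T_space] by (auto simp: T_plus_def zero_prod_def)
  then have eq: "tautological_cone N P v ori eps pth = {(xi, w). xi \<in> T_plus N P v ori eps
      \<and> (\<forall>(a, b)\<in>H. \<forall>k. a \<bullet> v k = b \<longrightarrow> a \<bullet> w \<le> a \<bullet> psi v xi (pth 0 k))}"
    by (intro tautological_cone_inequalities[OF \<open>polyhedron P\<close> assms(3,5) H assms(6)] assms(6))
  show ?thesis
    using sub polyhedral_tautological_cone[OF H(1)] unfolding eq by blast
qed

end
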